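(* A finite elation Laguerre plane $\mathbb{L}$ is ovoidal if and only if $\mathbb{L}\cong L(\overline{\mathcal{O}})$, where $\overline{\mathcal{O}}$ is an elementary dual pseudo-oval in $\mathrm{PG}(3n-1,q)$ (for some prime power $q$ and some $n\ge 1$).
   Context: A Laguerre plane is an incidence structure of points $\mathcal{P}$, lines $\mathcal{L}$ and circles $\mathcal{C}$ such that: (AX1) every point lies on a unique line; (AX2) a circle and a line meet in a unique point; (AX3) through three points, no two collinear, there is a unique circle; (AX4) if $P$ is a point on a circle $C$ and $Q$ is a point not on the line through $P$ and not on $C$, there is a unique circle through $P$ and $Q$ meeting $C$ only in $P$. In a finite Laguerre plane every circle has $s+1$ points for a constant $s$, the order. The kernel of a Laguerre plane is the group of automorphisms mapping every point to a point collinear with it (i.e. fixing every line). An elation Laguerre plane is a Laguerre plane whose kernel acts transitively on the circles. An ovoidal (finite) Laguerre plane is one that can be constructed (up to isomorphism) as follows, for some prime power $s$: take a cone $\mathcal{K}$ in $\mathrm{PG}(3,s)$ with vertex a point $V$ and base an oval ($s+1$ points, no three collinear) in a plane not containing $V$; points are the points of $\mathcal{K}\setminus\{V\}$, lines are the generators of $\mathcal{K}$, circles are the plane sections of $\mathcal{K}$ not containing $V$; incidence is natural. A pseudo-oval in $\mathrm{PG}(3n-1,q)$ is a set of $q^n+1$ subspaces of projective dimension $n-1$, any three of which span the whole space. A pseudo-oval is elementary if it is obtained from an oval of $\mathrm{PG}(2,q^n)$ by field reduction: under an $\mathbb{F}_q$-linear isomorphism $\mathbb{F}_{q^n}^3\cong\mathbb{F}_q^{3n}$,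 a point of $\mathrm{PG}(2,q^n)$ becomes an $(n-1)$-space of $\mathrm{PG}(3n-1,q)$. A dual pseudo-oval $\overline{\mathcal{O}}$ is the dual in $\mathrm{PG}(3n-1,q)$ of a pseudo-oval $\mathcal{O}$; it is a set of $q^n+1$ $(2n-1)$-spaces, and it is elementary if $\mathcal{O}$ is. Given a dual pseudo-oval $\overline{\mathcal{O}}$ in $H_\infty=\mathrm{PG}(3n-1,q)$, embed $H_\infty$ as a hyperplane of $\mathrm{PG}(3n,q)$. Then $L(\overline{\mathcal{O}})$ is the incidence structure with natural incidence whose points are the $2n$-spaces of $\mathrm{PG}(3n,q)$ meeting $H_\infty$ in an element of $\overline{\mathcal{O}}$, whose lines are the elements of $\overline{\mathcal{O}}$, and whose circles are the points of $\mathrm{PG}(3n,q)$ not in $H_\infty$. It is an elation Laguerre plane of order $q^n$. *)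

theory Defs
  imports "HOL-Algebra.Coset" "HOL-Algebra.Module" "Jordan_Normal_Form.Missing_VectorSpace"
begin

section \<open>Laguerre planes\<close>

record ('p, 'l, 'c) plc_structure =
  Points :: "'p set"
  Lines :: "'l set"
  Circles :: "'c set"
  on_line :: "'p \<Rightarrow> 'l \<Rightarrow> bool"
  on_circle :: "'p \<Rightarrow> 'c \<Rightarrow> bool"

definition finite_structure :: "('p, 'l, 'c) plc_structure \<Rightarrow> bool" where
  "finite_structure L \<longleftrightarrow> finite (Points L) \<and> finite (Lines L) \<and> finite (Circles L)"

definition collinear_pts :: "('p, 'l, 'c) plc_structure \<Rightarrow> 'p \<Rightarrow> 'p \<Rightarrow> bool" where
  "collinear_pts L P Q \<longleftrightarrow> (\<exists>l\<in>Lines L. on_line L P l \<and> on_line L Q l)"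

text \<open>In the third axiom the three points are automatically distinct, since by the first axiom
  every point is collinear with itself.\<close>

definition laguerre_plane :: "('p, 'l, 'c) plc_structure \<Rightarrow> bool" where
  "laguerre_plane L \<longleftrightarrow>
     (\<forall>P\<in>Points L. \<exists>!l. l \<in> Lines L \<and> on_line L P l) \<and>
     (\<forall>C\<in>Circles L. \<forall>l\<in>Lines L. \<exists>!P. P \<in> Points L \<and> on_circle L P C \<and> on_line L P l) \<and>
     (\<forall>P\<in>Points L. \<forall>Q\<in>Points L. \<forall>R\<in>Points L.
        \<not> collinear_pts L P Q \<longrightarrow> \<not> collinear_pts L P R \<longrightarrow> \<not> collinear_pts L Q R \<longrightarrow>
        (\<exists>!C. C \<in> Circles L \<and> on_circle L P C \<and> on_circle L Q C \<and> on_circle L R C)) \<and>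
     (\<forall>P\<in>Points L. \<forall>Q\<in>Points L. \<forall>C\<in>Circles L.
        on_circle L P C \<longrightarrow> \<not> on_circle L Q C \<longrightarrow> \<not> collinear_pts L P Q \<longrightarrow>
        (\<exists>!D. D \<in> Circles L \<and> on_circle L P D \<and> on_circle L Q D \<and>
              {X \<in> Points L. on_circle L X C \<and> on_circle L X D} = {P}))"

definition isomorphism ::
  "('p, 'l, 'c) plc_structure \<Rightarrow> ('p', 'l', 'c') plc_structure \<Rightarrow>
   ('p \<Rightarrow> 'p') \<Rightarrow> ('l \<Rightarrow> 'l') \<Rightarrow> ('c \<Rightarrow> 'c') \<Rightarrow> bool" where
  "isomorphism L M f g h \<longleftrightarrow>
     bij_betw f (Points L) (Points M) \<and>
     bij_betw g (Lines L) (Lines M) \<and>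
     bij_betw h (Circles L) (Circles M) \<and>
     (\<forall>P\<in>Points L. \<forall>l\<in>Lines L. on_line M (f P) (g l) \<longleftrightarrow> on_line L P l) \<and>
     (\<forall>P\<in>Points L. \<forall>C\<in>Circles L. on_circle M (f P) (h C) \<longleftrightarrow> on_circle L P C)"

definition isomorphic ::
  "('p, 'l, 'c) plc_structure \<Rightarrow> ('p', 'l', 'c') plc_structure \<Rightarrow> bool" where
  "isomorphic L M \<longleftrightarrow> (\<exists>f g h. isomorphism L M f g h)"

definition kernel_auts ::
  "('p, 'l, 'c) plc_structure \<Rightarrow> (('p \<Rightarrow> 'p) \<times> ('l \<Rightarrow> 'l) \<times> ('c \<Rightarrow> 'c)) set" where
  "kernel_auts L =
     {(f, g, h). isomorphism L L f g h \<and> (\<forall>P\<in>Points L. collinear_pts L P (f P))}"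

definition elation_laguerre_plane :: "('p, 'l, 'c) plc_structure \<Rightarrow> bool" where
  "elation_laguerre_plane L \<longleftrightarrow>
     laguerre_plane L \<and>
     (\<forall>C\<in>Circles L. \<forall>D\<in>Circles L. \<exists>(f, g, h)\<in>kernel_auts L. h C = D)"


section \<open>Projective spaces over finite fields\<close>

text \<open>The order of a finite field is a prime power, and every prime power is the order of a finite
  field with carrier a set of natural numbers, unique up to isomorphism.  Existence of a
  prime power q together with the geometry PG(N,q) is therefore expressed by existence of a
  finite field of type \<open>nat ring\<close>, with q the order of that field.\<close>

definition galois_field :: "'a ring \<Rightarrow> bool" where
  "galois_field F \<longleftrightarrow> field F \<and> finite (carrier F)"

abbreviation coord_space :: "'a ring \<Rightarrow> nat \<Rightarrow> ('a, nat \<Rightarrow> 'a) module" where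
  "coord_space F m \<equiv> ring.func_space F {..<m}"

text \<open>The subspaces of projective dimension \<open>d\<close>, that is of vector space dimension \<open>d + 1\<close>, of
  the \<open>N\<close>-dimensional projective space over \<open>F\<close>.\<close>

definition pg_subspaces :: "'a ring \<Rightarrow> nat \<Rightarrow> nat \<Rightarrow> (nat \<Rightarrow> 'a) set set" where
  "pg_subspaces F N d =
     {U. subspace F U (coord_space F (N + 1)) \<and>
         vectorspace.dim F ((coord_space F (N + 1))\<lparr>carrier := U\<rparr>) = d + 1}"

definition oval :: "'a ring \<Rightarrow> nat \<Rightarrow> (nat \<Rightarrow> 'a) set \<Rightarrow> (nat \<Rightarrow> 'a) set set \<Rightarrow> bool" where
  "oval F N \<pi> B \<longleftrightarrow>
     \<pi> \<in> pg_subspaces F N 2 \<and>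
     B \<subseteq> {P \<in> pg_subspaces F N 0. P \<subseteq> \<pi>} \<and>
     card B = order F + 1 \<and>
     (\<forall>P\<in>B. \<forall>Q\<in>B. \<forall>R\<in>B. P \<noteq> Q \<longrightarrow> P \<noteq> R \<longrightarrow> Q \<noteq> R \<longrightarrow>
        \<not> (\<exists>l\<in>pg_subspaces F N 1. P \<subseteq> l \<and> Q \<subseteq> l \<and> R \<subseteq> l))"


section \<open>Ovoidal Laguerre planes\<close>

definition generators :: "'a ring \<Rightarrow> (nat \<Rightarrow> 'a) set \<Rightarrow> (nat \<Rightarrow> 'a) set set \<Rightarrow> (nat \<Rightarrow> 'a) set set" where
  "generators F V B = {g \<in> pg_subspaces F 3 1. V \<subseteq> g \<and> (\<exists>P\<in>B. P \<subseteq> g)}"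

definition cone :: "'a ring \<Rightarrow> (nat \<Rightarrow> 'a) set \<Rightarrow> (nat \<Rightarrow> 'a) set set \<Rightarrow> (nat \<Rightarrow> 'a) set set" where
  "cone F V B = {X \<in> pg_subspaces F 3 0. \<exists>g\<in>generators F V B. X \<subseteq> g}"

text \<open>A circle is a plane section, taken as a set of projective points.\<close>

definition cone_structure ::
  "'a ring \<Rightarrow> (nat \<Rightarrow> 'a) set \<Rightarrow> (nat \<Rightarrow> 'a) set set \<Rightarrow>
   ((nat \<Rightarrow> 'a) set, (nat \<Rightarrow> 'a) set, (nat \<Rightarrow> 'a) set set) plc_structure" where
  "cone_structure F V B =
     \<lparr>Points = cone F V B - {V},
      Lines = generators F V B,
      Circles = {{X \<in> cone F V B. X \<subseteq> \<rho>} | \<rho>. \<rho> \<in> pg_subspaces F 3 2 \<and> \<not> V \<subseteq> \<rho>},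
      on_line = (\<lambda>X g. X \<subseteq> g),
      on_circle = (\<lambda>X C. X \<in> C)\<rparr>"

definition ovoidal :: "('p, 'l, 'c) plc_structure \<Rightarrow> bool" where
  "ovoidal L \<longleftrightarrow>
     (\<exists>(F :: nat ring) V \<pi> B.
        galois_field F \<and> V \<in> pg_subspaces F 3 0 \<and> \<not> V \<subseteq> \<pi> \<and> oval F 3 \<pi> B \<and>
        isomorphic L (cone_structure F V B))"


section \<open>Pseudo-ovals\<close>

definition pseudo_oval :: "'a ring \<Rightarrow> nat \<Rightarrow> (nat \<Rightarrow> 'a) set set \<Rightarrow> bool" where
  "pseudo_oval F n A \<longleftrightarrow>
     A \<subseteq> pg_subspaces F (3 * n - 1) (n - 1) \<and>
     card A = order F ^ n + 1 \<and>
     (\<forall>X\<in>A. \<forall>Y\<in>A. \<forall>Z\<in>A. X \<noteq> Y \<longrightarrow> X \<noteq> Z \<longrightarrow> Y \<noteq> Z \<longrightarrow>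
        LinearCombinations.module.span F (coord_space F (3 * n)) (X \<union> Y \<union> Z) =
          carrier (coord_space F (3 * n)))"

definition restrict_scalars ::
  "('a \<Rightarrow> 'a) \<Rightarrow> ('a, 'v) module \<Rightarrow> ('a, 'v) module" where
  "restrict_scalars \<phi> M = M\<lparr>smult := (\<lambda>a x. \<phi> a \<odot>\<^bsub>M\<^esub> x)\<rparr>"

text \<open>Here \<open>K\<close> is the extension of degree \<open>n\<close>, \<open>\<phi>\<close> the embedding of \<open>F\<close> into \<open>K\<close>, and \<open>T\<close> the
  \<open>F\<close>-linear isomorphism defining the field reduction.\<close>

definition elementary_pseudo_oval :: "nat ring \<Rightarrow> nat \<Rightarrow> (nat \<Rightarrow> nat) set set \<Rightarrow> bool" where
  "elementary_pseudo_oval F n A \<longleftrightarrow>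
     pseudo_oval F n A \<and>
     (\<exists>(K :: nat ring) \<phi> T B.
        galois_field K \<and> order K = order F ^ n \<and> \<phi> \<in> ring_hom F K \<and>
        T \<in> module_hom F (restrict_scalars \<phi> (coord_space K 3)) (coord_space F (3 * n)) \<and>
        bij_betw T (carrier (coord_space K 3)) (carrier (coord_space F (3 * n))) \<and>
        oval K 2 (carrier (coord_space K 3)) B \<and>
        A = (\<lambda>P. T ` P) ` B)"

text \<open>The duality of the projective space on \<open>coord_space F m\<close> is the one given by the standard
  bilinear form.\<close>

definition perp :: "'a ring \<Rightarrow> nat \<Rightarrow> (nat \<Rightarrow> 'a) set \<Rightarrow> (nat \<Rightarrow> 'a) set" where
  "perp F m U =
     {x \<in> carrier (coord_space F m).
        \<forall>u\<in>U. (\<Oplus>\<^bsub>F\<^esub>i\<in>{..<m}. x i \<otimes>\<^bsub>F\<^esub> u i) = \<zero>\<^bsub>F\<^esub>}"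

definition elementary_dual_pseudo_oval :: "nat ring \<Rightarrow> nat \<Rightarrow> (nat \<Rightarrow> nat) set set \<Rightarrow> bool" where
  "elementary_dual_pseudo_oval F n D \<longleftrightarrow>
     (\<exists>A. elementary_pseudo_oval F n A \<and> D = perp F (3 * n) ` A)"


section \<open>The structure obtained from a dual pseudo-oval\<close>

text \<open>The space at infinity is embedded as the hyperplane on which the last coordinate (index
  \<open>3 * n\<close>) is zero.\<close>

definition hyperplane_at_infinity :: "'a ring \<Rightarrow> nat \<Rightarrow> (nat \<Rightarrow> 'a) set" where
  "hyperplane_at_infinity F n =
     {x \<in> carrier (coord_space F (3 * n + 1)). x (3 * n) = \<zero>\<^bsub>F\<^esub>}"

definition at_infinity :: "'a ring \<Rightarrow> nat \<Rightarrow> (nat \<Rightarrow> 'a) set \<Rightarrow> (nat \<Rightarrow> 'a) set" where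
  "at_infinity F n U = (\<lambda>x. x(3 * n := \<zero>\<^bsub>F\<^esub>)) ` U"

definition L_structure ::
  "'a ring \<Rightarrow> nat \<Rightarrow> (nat \<Rightarrow> 'a) set set \<Rightarrow>
   ((nat \<Rightarrow> 'a) set, (nat \<Rightarrow> 'a) set, (nat \<Rightarrow> 'a) set) plc_structure" where
  "L_structure F n D =
     \<lparr>Points = {A \<in> pg_subspaces F (3 * n) (2 * n).
                 A \<inter> hyperplane_at_infinity F n \<in> at_infinity F n ` D},
      Lines = at_infinity F n ` D,
      Circles = {P \<in> pg_subspaces F (3 * n) 0. \<not> P \<subseteq> hyperplane_at_infinity F n},
      on_line = (\<lambda>A E. E \<subseteq> A),
      on_circle = (\<lambda>A P. P \<subseteq> A)\<rparr>"

end

theory Submission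
  imports Defs
begin

text \<open>Both kinds of structure are compared with a model in coordinates over a finite field \<open>K\<close>:
  circles are the vectors \<open>a\<close> of \<open>K\<^sup>3\<close>, lines are the points \<open>P\<close> of an oval of \<open>PG(2, K)\<close>, points
  are the pairs \<open>(P, t)\<close> with \<open>t\<close> in \<open>K\<close>, and \<open>(P, t)\<close> is on \<open>a\<close> iff the scalar product of \<open>a\<close> with a
  fixed representative of \<open>P\<close> is \<open>t\<close>.  With the base plane of a cone as \<open>K\<^sup>3\<close> and the vertex as fourth
  coordinate, a plane missing the vertex is the graph of a linear functional, hence a vector \<open>a\<close>; this
  identifies the cone with the model.  In the dual setting, composing the scalar product of \<open>K\<^sup>3\<close> with a
  nonzero \<open>F\<close>-linear functional \<open>K \<rightarrow> F\<close> gives a nondegenerate form, which turns the perp of a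
  field-reduced point into the annihilator of that point over \<open>K\<close>; this identifies \<open>L_structure\<close> with
  the model.  The converse direction is the case \<open>n = 1\<close>.  Dimensions are computed by counting: a
  subspace has dimension \<open>d\<close> iff it has \<open>q\<^sup>d\<close> elements.\<close>

text \<open>The model fits both sides because the pairing of \<open>a\<close> with
  \<open>rep P\<close> can be read in two ways. In the cone, \<open>a\<close> is a plane and
  \<open>P\<close> a point of the base. In the dual setting, \<open>a\<close> is an affine point and
  \<open>P\<close> a family of parallel subspaces, one for each \<open>t\<close>. Fixing a
  representative of \<open>P\<close> is what fixes the parameter \<open>t\<close>. The obstacle is
  that \<open>perp\<close> uses the standard form over \<open>F\<close> while \<open>T\<close> is an
  arbitrary \<open>F\<close>-linear bijection, so this form knows nothing of the multiplication by
  \<open>K\<close>. For this reason K^3 is carried to the hyperplane at infinity not by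
  \<open>T\<close> but by an adjoint \<open>R\<close> of it. Annihilators over \<open>F\<close> and
  over \<open>K\<close> then agree because each point of the oval is closed under multiplication by
  \<open>K\<close>. Both comparisons use the same device: an \<open>F\<close>-linear bijection
  \<open>\<Theta>\<close> from K^3 x F onto a coordinate space over \<open>F\<close>. Once the
  relevant subspaces are written as conditions on pairs \<open>(a, z)\<close>, incidence with them
  is a computation with scalar products.\<close>

lemma subspace_iff:
  assumes "vectorspace K V"
  shows "subspace K W V \<longleftrightarrow> W \<subseteq> carrier V \<and> \<zero>\<^bsub>V\<^esub> \<in> W \<and>
    (\<forall>x\<in>W. \<forall>y\<in>W. x \<oplus>\<^bsub>V\<^esub> y \<in> W) \<and> (\<forall>c\<in>carrier K. \<forall>x\<in>W. c \<odot>\<^bsub>V\<^esub> x \<in> W)"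
  using assms by (auto simp: subspace_def submodule_def vectorspace_def)

text \<open>The coefficients in \<open>lincomb\<close> are indexed by the basis vectors themselves;
  composing with an enumeration \<open>u\<close> of the basis replaces these indices by numbers.
  Finiteness of the carrier gives a finite spanning set, namely the carrier, and hence a finite
  basis.\<close>

lemma coordinate_isomorphism:
  assumes "vectorspace K V" and finite_V: "finite (carrier V)"
  obtains \<psi> where "\<psi> \<in> module_hom K (coord_space K (vectorspace.dim K V)) V"
    and "bij_betw \<psi> (carrier (coord_space K (vectorspace.dim K V))) (carrier V)"
proof -
  interpret vectorspace K V by fact
  have "span (carrier V) = carrier V"
    using in_own_span[of "carrier V"] span_is_subset2[of "carrier V"] by (meson order_refl subset_antisym)
  then have "fin_dim"
    unfolding fin_dim_def using finite_V by (intro exI[of _ "carrier V"]) simp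
  then obtain \<beta> where \<beta>: "finite \<beta>" "basis \<beta>"
    using finite_basis_exists by blast
  have \<beta>V: "\<beta> \<subseteq> carrier V" using \<beta> by (auto simp: basis_def)
  have d: "dim = card \<beta>" using \<beta> by (rule dim_basis)
  obtain u where u: "bij_betw u \<beta> {..<dim}"
    unfolding d using \<beta>(1) ex_bij_betw_finite_nat[of \<beta>] by (auto simp: atLeast0LessThan)
  define \<rho> where "\<rho> x = (\<lambda>v\<in>\<beta>. x (u v))" for x :: "nat \<Rightarrow> 'a"
  have u_less: "u v < dim" if "v \<in> \<beta>" for v
    using u that by (auto simp: bij_betw_def)
  have \<rho>_bij: "bij_betw \<rho> (carrier (func_space {..<dim})) (carrier (func_space \<beta>))"
  proof (rule bij_betw_byWitness[where f' = "\<lambda>y. \<lambda>i\<in>{..<dim}. y (inv_into \<beta> u i)"])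
    show "\<forall>x\<in>carrier (func_space {..<dim}). (\<lambda>i\<in>{..<dim}. \<rho> x (inv_into \<beta> u i)) = x"
      using u by (auto simp: func_space_def \<rho>_def fun_eq_iff PiE_def extensional_def
        bij_betw_inv_into_right bij_betw_def inv_into_into)
    show "\<forall>y\<in>carrier (func_space \<beta>). \<rho> (\<lambda>i\<in>{..<dim}. y (inv_into \<beta> u i)) = y"
      using u u_less by (auto simp: func_space_def \<rho>_def fun_eq_iff PiE_def extensional_def
        bij_betw_inv_into_left)
    show "\<rho> ` carrier (func_space {..<dim}) \<subseteq> carrier (func_space \<beta>)"
      using u_less by (auto simp: func_space_def \<rho>_def)
    show "(\<lambda>y. \<lambda>i\<in>{..<dim}. y (inv_into \<beta> u i)) ` carrier (func_space \<beta>)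
        \<subseteq> carrier (func_space {..<dim})"
      using u by (auto simp: func_space_def bij_betw_def intro!: inv_into_into)
  qed
  interpret lc: linear_map K "func_space \<beta>" V "\<lambda>a. lincomb a \<beta>"
    by (rule lincomb_is_linear) (use \<beta> \<beta>V in auto)
  have lc_bij: "bij_betw (\<lambda>a. lincomb a \<beta>) (carrier (func_space \<beta>)) (carrier V)"
  proof -
    have ex1: "\<exists>!a. a \<in> carrier (func_space \<beta>) \<and> lincomb a \<beta> = v" if "v \<in> carrier V" for v
      using basis_criterion[OF \<beta>(1) \<beta>V] \<beta>(2) that by (auto simp: func_space_def)
    show ?thesis
      unfolding bij_betw_def inj_on_def image_def
      using ex1 lc.f_im by (auto, metis)
  qed
  have add: "\<rho> (x \<oplus>\<^bsub>func_space {..<dim}\<^esub> y) = \<rho> x \<oplus>\<^bsub>func_space \<beta>\<^esub> \<rho> y" for x y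
    using u_less by (auto simp: func_space_def \<rho>_def fun_eq_iff)
  have smult: "\<rho> (c \<odot>\<^bsub>func_space {..<dim}\<^esub> x) = c \<odot>\<^bsub>func_space \<beta>\<^esub> \<rho> x" for c x
    using u_less by (auto simp: func_space_def \<rho>_def fun_eq_iff)
  have \<rho>_im: "\<rho> x \<in> carrier (func_space \<beta>)" if "x \<in> carrier (func_space {..<dim})" for x
    using \<rho>_bij that by (auto simp: bij_betw_def)
  show thesis
  proof (rule that[of "(\<lambda>a. lincomb a \<beta>) \<circ> \<rho>"])
    show "(\<lambda>a. lincomb a \<beta>) \<circ> \<rho> \<in> module_hom K (coord_space K dim) V"
      using \<rho>_im by (auto simp: module_hom_def add smult)
    show "bij_betw ((\<lambda>a. lincomb a \<beta>) \<circ> \<rho>) (carrier (coord_space K dim)) (carrier V)"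
      using \<rho>_bij lc_bij by (rule bij_betw_trans)
  qed
qed

section \<open>Coordinate spaces over a finite field and the size of their subspaces\<close>

locale finite_field = field F for F :: "'a ring" (structure) +
  assumes finite_carrier: "finite (carrier F)"
begin

abbreviation vec :: "nat \<Rightarrow> ('a, nat \<Rightarrow> 'a) module"
  where "vec m \<equiv> func_space {..<m}"

lemma vec_module: "module F (vec m)"
  by (rule func_space_is_module)

lemma vec_vectorspace: "vectorspace F (vec m)"
  using vec_module field_axioms by (simp add: vectorspace_def)

lemma carrier_vec: "carrier (vec m) = {..<m} \<rightarrow>\<^sub>E carrier F"
  by (simp add: func_space_def)

lemma vec_coord [simp]: "x \<in> carrier (vec m) \<Longrightarrow> i < m \<Longrightarrow> x i \<in> carrier F"
  by (auto simp: carrier_vec)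

lemma vec_eqI: "x \<in> carrier (vec m) \<Longrightarrow> y \<in> carrier (vec m) \<Longrightarrow> (\<And>i. i < m \<Longrightarrow> x i = y i) \<Longrightarrow> x = y"
  by (auto simp: carrier_vec intro: PiE_ext)

lemma vec_add_coord [simp]: "i < m \<Longrightarrow> (x \<oplus>\<^bsub>vec m\<^esub> y) i = x i \<oplus> y i"
  by (simp add: func_space_def)

lemma vec_smult_coord [simp]: "i < m \<Longrightarrow> (c \<odot>\<^bsub>vec m\<^esub> x) i = c \<otimes> x i"
  by (simp add: func_space_def)

lemma vec_zero_coord [simp]: "i < m \<Longrightarrow> \<zero>\<^bsub>vec m\<^esub> i = \<zero>"
  by (simp add: func_space_def)

lemma vec_add_closed [simp]:
  "x \<in> carrier (vec m) \<Longrightarrow> y \<in> carrier (vec m) \<Longrightarrow> x \<oplus>\<^bsub>vec m\<^esub> y \<in> carrier (vec m)"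
  using vec_module[of m] by (meson abelian_monoid.a_closed abelian_group.axioms(1) module.axioms(2))

lemma vec_smult_closed [simp]:
  "c \<in> carrier F \<Longrightarrow> x \<in> carrier (vec m) \<Longrightarrow> c \<odot>\<^bsub>vec m\<^esub> x \<in> carrier (vec m)"
  using vec_module[of m] by (rule module.smult_closed)

lemma vec_zero_closed [simp]: "\<zero>\<^bsub>vec m\<^esub> \<in> carrier (vec m)"
  by (auto simp: func_space_def)

lemma finite_vec: "finite (carrier (vec m))"
  by (simp add: carrier_vec finite_PiE finite_carrier)

lemma card_vec: "card (carrier (vec m)) = order F ^ m"
  by (simp add: carrier_vec card_PiE order_def)

lemma order_gt_1: "order F > 1"
proof -
  have "card {\<zero>, \<one>} \<le> order F"
    unfolding order_def by (rule card_mono) (auto simp: finite_carrier)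
  then show ?thesis by simp
qed

lemma card_vectorspace:
  assumes "vectorspace F V" and "finite (carrier V)"
  shows "card (carrier V) = order F ^ vectorspace.dim F V"
  using coordinate_isomorphism[OF assms] bij_betw_same_card card_vec by metis

lemma subspace_vec_iff:
  "subspace F W (vec m) \<longleftrightarrow> W \<subseteq> carrier (vec m) \<and> \<zero>\<^bsub>vec m\<^esub> \<in> W \<and>
    (\<forall>x\<in>W. \<forall>y\<in>W. x \<oplus>\<^bsub>vec m\<^esub> y \<in> W) \<and> (\<forall>c\<in>carrier F. \<forall>x\<in>W. c \<odot>\<^bsub>vec m\<^esub> x \<in> W)"
  by (rule subspace_iff[OF vec_vectorspace])

lemma card_subspace:
  assumes "subspace F W (vec m)"
  shows "card W = order F ^ vectorspace.dim F ((vec m)\<lparr>carrier := W\<rparr>)"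
proof -
  have "W \<subseteq> carrier (vec m)" using assms by (simp add: subspace_vec_iff)
  then have "finite W" using finite_vec finite_subset by blast
  then show ?thesis
    using card_vectorspace[OF vectorspace.subspace_is_vs[OF vec_vectorspace assms]] by simp
qed

text \<open>Powers of the order are injective because the order exceeds 1. Since \<open>d\<close> is
  a projective dimension, the exponent is \<open>d + 1\<close>.\<close>

lemma pg_subspaces_iff:
  "U \<in> pg_subspaces F N d \<longleftrightarrow> subspace F U (vec (N + 1)) \<and> card U = order F ^ (d + 1)"
proof -
  have "vectorspace.dim F ((vec (N + 1))\<lparr>carrier := U\<rparr>) = d + 1 \<longleftrightarrow> card U = order F ^ (d + 1)"
    if "subspace F U (vec (N + 1))"
    using power_inject_exp[OF order_gt_1] unfolding card_subspace[OF that] by metis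
  then show ?thesis
    unfolding pg_subspaces_def by blast
qed

section \<open>The scalar product and linear functionals\<close>

definition dot :: "nat \<Rightarrow> (nat \<Rightarrow> 'a) \<Rightarrow> (nat \<Rightarrow> 'a) \<Rightarrow> 'a"
  where "dot m x y = (\<Oplus>i\<in>{..<m}. x i \<otimes> y i)"

definition unit_vector :: "nat \<Rightarrow> nat \<Rightarrow> nat \<Rightarrow> 'a"
  where "unit_vector m i = (\<lambda>j\<in>{..<m}. if j = i then \<one> else \<zero>)"

lemma unit_vector_closed [simp]: "unit_vector m i \<in> carrier (vec m)"
  by (auto simp: unit_vector_def carrier_vec)

lemma dot_closed [simp]: "x \<in> carrier (vec m) \<Longrightarrow> y \<in> carrier (vec m) \<Longrightarrow> dot m x y \<in> carrier F"
  unfolding dot_def by (rule finsum_closed) auto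

lemma dot_comm: "x \<in> carrier (vec m) \<Longrightarrow> y \<in> carrier (vec m) \<Longrightarrow> dot m x y = dot m y x"
  unfolding dot_def by (rule finsum_cong') (auto simp: m_comm)

lemma dot_add_left:
  assumes "x \<in> carrier (vec m)" "y \<in> carrier (vec m)" "z \<in> carrier (vec m)"
  shows "dot m (x \<oplus>\<^bsub>vec m\<^esub> y) z = dot m x z \<oplus> dot m y z"
proof -
  have "dot m (x \<oplus>\<^bsub>vec m\<^esub> y) z = (\<Oplus>i\<in>{..<m}. x i \<otimes> z i \<oplus> y i \<otimes> z i)"
    unfolding dot_def by (rule finsum_cong') (use assms in \<open>auto simp: l_distr\<close>)
  also have "\<dots> = dot m x z \<oplus> dot m y z"
    unfolding dot_def by (rule finsum_addf) (use assms in auto)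
  finally show ?thesis .
qed

lemma dot_smult_left:
  assumes "c \<in> carrier F" "x \<in> carrier (vec m)" "y \<in> carrier (vec m)"
  shows "dot m (c \<odot>\<^bsub>vec m\<^esub> x) y = c \<otimes> dot m x y"
proof -
  have "dot m (c \<odot>\<^bsub>vec m\<^esub> x) y = (\<Oplus>i\<in>{..<m}. c \<otimes> (x i \<otimes> y i))"
    unfolding dot_def by (rule finsum_cong') (use assms in \<open>auto simp: m_assoc\<close>)
  also have "\<dots> = c \<otimes> dot m x y"
    unfolding dot_def by (rule finsum_rdistr[symmetric]) (use assms in auto)
  finally show ?thesis .
qed

lemma dot_add_right:
  "x \<in> carrier (vec m) \<Longrightarrow> y \<in> carrier (vec m) \<Longrightarrow> z \<in> carrier (vec m) \<Longrightarrow>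
    dot m z (x \<oplus>\<^bsub>vec m\<^esub> y) = dot m z x \<oplus> dot m z y"
  using dot_add_left[of x m y z] by (simp add: dot_comm[of z])

lemma dot_smult_right:
  "c \<in> carrier F \<Longrightarrow> x \<in> carrier (vec m) \<Longrightarrow> y \<in> carrier (vec m) \<Longrightarrow>
    dot m y (c \<odot>\<^bsub>vec m\<^esub> x) = c \<otimes> dot m y x"
  using dot_smult_left[of c x m y] by (simp add: dot_comm[of y])

lemma dot_zero_right [simp]: "x \<in> carrier (vec m) \<Longrightarrow> dot m x \<zero>\<^bsub>vec m\<^esub> = \<zero>"
  unfolding dot_def by (rule finsum_zero') auto

text \<open>Consecutive truncations of \<open>y\<close> differ by a multiple of one unit vector, so
  additivity and homogeneity build up the value of \<open>g\<close> one coordinate at a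
  time.\<close>

lemma linear_functional_eq_dot:
  assumes g: "g \<in> carrier (vec m) \<rightarrow> carrier F"
    and g_add: "\<And>x y. x \<in> carrier (vec m) \<Longrightarrow> y \<in> carrier (vec m) \<Longrightarrow>
      g (x \<oplus>\<^bsub>vec m\<^esub> y) = g x \<oplus> g y"
    and g_smult: "\<And>c x. c \<in> carrier F \<Longrightarrow> x \<in> carrier (vec m) \<Longrightarrow>
      g (c \<odot>\<^bsub>vec m\<^esub> x) = c \<otimes> g x"
    and y: "y \<in> carrier (vec m)"
  shows "g y = dot m (\<lambda>i\<in>{..<m}. g (unit_vector m i)) y"
proof -
  define trunc where "trunc k = (\<lambda>i\<in>{..<m}. if i < k then y i else \<zero>)" for k
  have trunc: "trunc k \<in> carrier (vec m)" for k
    using y by (auto simp: trunc_def carrier_vec)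
  have gu: "g (unit_vector m i) \<in> carrier F" for i
    using g by auto
  have "g (trunc k) = (\<Oplus>i\<in>{..<k}. g (unit_vector m i) \<otimes> y i)" if "k \<le> m" for k
    using that
  proof (induction k)
    case 0
    \<comment> \<open>Writing the zero vector as zero times itself lets homogeneity give the value
      zero at once, where additivity would require a cancellation.\<close>
    have "trunc 0 = \<zero> \<odot>\<^bsub>vec m\<^esub> trunc 0"
      by (rule vec_eqI[of _ m]) (auto simp: trunc, auto simp: trunc_def)
    then have "g (trunc 0) = \<zero> \<otimes> g (trunc 0)"
      using g_smult[of \<zero> "trunc 0"] trunc by simp
    moreover have "g (trunc 0) \<in> carrier F"
      using g trunc[of 0] by blast
    ultimately show ?case by simp
  next
    case (Suc k)
    have yk: "y k \<in> carrier F" using y Suc.prems by simp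
    have "trunc (Suc k) = trunc k \<oplus>\<^bsub>vec m\<^esub> (y k \<odot>\<^bsub>vec m\<^esub> unit_vector m k)"
      by (rule vec_eqI[of _ m])
        (use yk y in \<open>auto simp: trunc, auto simp: trunc_def unit_vector_def less_Suc_eq\<close>)
    then have "g (trunc (Suc k)) = g (trunc k) \<oplus> y k \<otimes> g (unit_vector m k)"
      using g_add trunc g_smult yk by simp
    also have "g (trunc k) = (\<Oplus>i\<in>{..<k}. g (unit_vector m i) \<otimes> y i)"
      using Suc by simp
    also have "\<dots> \<oplus> y k \<otimes> g (unit_vector m k) = (\<Oplus>i\<in>{..<Suc k}. g (unit_vector m i) \<otimes> y i)"
    proof -
      have "(\<lambda>i. g (unit_vector m i) \<otimes> y i) \<in> {..<k} \<rightarrow> carrier F"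
        using y gu Suc.prems by (auto intro!: m_closed)
      then show ?thesis
        using gu yk by (simp add: lessThan_Suc m_comm a_comm)
    qed
    finally show ?case .
  qed
  moreover have "trunc m = y"
    by (rule vec_eqI[of _ m]) (use y in \<open>auto simp: trunc, auto simp: trunc_def\<close>)
  moreover have "(\<Oplus>i\<in>{..<m}. g (unit_vector m i) \<otimes> y i) = dot m (\<lambda>i\<in>{..<m}. g (unit_vector m i)) y"
    unfolding dot_def by (rule finsum_cong') (use y gu in auto)
  ultimately show ?thesis by fastforce
qed

text \<open>Taking coordinate \<open>i\<close> is itself a linear functional, and its values on the
  unit vectors are the entries of \<open>unit_vector m i\<close>.\<close>

lemma dot_unit_vector [simp]:
  assumes "x \<in> carrier (vec m)" "i < m"
  shows "dot m x (unit_vector m i) = x i" and "dot m (unit_vector m i) x = x i"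
proof -
  have "x i = dot m (\<lambda>j\<in>{..<m}. unit_vector m j i) x"
    by (rule linear_functional_eq_dot[where g = "\<lambda>x. x i"]) (use assms in auto)
  also have "(\<lambda>j\<in>{..<m}. unit_vector m j i) = unit_vector m i"
    using assms by (auto simp: unit_vector_def)
  finally show "dot m (unit_vector m i) x = x i" by simp
  then show "dot m x (unit_vector m i) = x i"
    using assms dot_comm by simp
qed

lemma dot_left_cancel:
  assumes "a \<in> carrier (vec m)" "b \<in> carrier (vec m)"
    and "\<And>x. x \<in> carrier (vec m) \<Longrightarrow> dot m a x = dot m b x"
  shows "a = b"
proof (rule vec_eqI[OF assms(1,2)])
  show "a i = b i" if "i < m" for i
    using assms(3)[OF unit_vector_closed[of m i]] assms(1,2) that by simp
qed

lemma vec_nonzero_coord: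
  assumes "x \<in> carrier (vec m)" "x \<noteq> \<zero>\<^bsub>vec m\<^esub>"
  obtains i where "i < m" "x i \<noteq> \<zero>"
  using assms vec_eqI[of x m "\<zero>\<^bsub>vec m\<^esub>"] by auto

lemma vec_smult_cancel:
  assumes "x \<in> carrier (vec m)" "x \<noteq> \<zero>\<^bsub>vec m\<^esub>" "c \<in> carrier F" "d \<in> carrier F"
    and "c \<odot>\<^bsub>vec m\<^esub> x = d \<odot>\<^bsub>vec m\<^esub> x"
  shows "c = d"
proof -
  obtain i where i: "i < m" "x i \<noteq> \<zero>"
    using vec_nonzero_coord assms by blast
  have "c \<otimes> x i = d \<otimes> x i"
    using assms(5) i by (metis vec_smult_coord)
  then show ?thesis
    using m_rcancel[of "x i" c d] i assms by simp
qed

lemma dot_surj: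
  assumes "r \<in> carrier (vec m)" "r \<noteq> \<zero>\<^bsub>vec m\<^esub>" "t \<in> carrier F"
  obtains a where "a \<in> carrier (vec m)" "dot m a r = t"
proof -
  obtain i where i: "i < m" "r i \<noteq> \<zero>"
    using vec_nonzero_coord assms by blast
  have [simp]: "r i \<in> carrier F" using i assms by simp
  then have [simp]: "inv (r i) \<in> carrier F" using i by simp
  have "r i \<in> Units F" using i field_Units by simp
  then have "dot m ((t \<otimes> inv (r i)) \<odot>\<^bsub>vec m\<^esub> unit_vector m i) r = t"
    using i assms by (simp add: dot_smult_left m_assoc)
  then show thesis using that[of "(t \<otimes> inv (r i)) \<odot>\<^bsub>vec m\<^esub> unit_vector m i"] assms by simp
qed

text \<open>Translation by a vector whose product with \<open>r\<close> is \<open>t - s\<close>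
  injects the fibre over \<open>s\<close> into the fibre over \<open>t\<close>. All fibres therefore
  have the same size, and \<open>order F\<close> of them partition the whole space. The dimension is
  written \<open>Suc m\<close> so that the count involves no subtraction.\<close>

lemma card_dot_fibre:
  assumes r: "r \<in> carrier (vec (Suc m))" "r \<noteq> \<zero>\<^bsub>vec (Suc m)\<^esub>" and t: "t \<in> carrier F"
  shows "card {a \<in> carrier (vec (Suc m)). dot (Suc m) a r = t} = order F ^ m"
proof -
  let ?V = "vec (Suc m)"
  define fib where "fib t = {a \<in> carrier ?V. dot (Suc m) a r = t}" for t
  have fin: "finite (fib t)" for t
    by (rule finite_subset[OF _ finite_vec[of "Suc m"]]) (auto simp: fib_def)
  interpret V: module F ?V by (rule vec_module)
  have le: "card (fib s) \<le> card (fib t)" if st: "s \<in> carrier F" "t \<in> carrier F" for s t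
  proof -
    obtain u where u: "u \<in> carrier ?V" "dot (Suc m) u r = t \<ominus> s"
      using dot_surj[of r "Suc m" "t \<ominus> s"] r st by auto
    show ?thesis
    proof (rule card_inj_on_le[of "\<lambda>a. a \<oplus>\<^bsub>?V\<^esub> u"])
      show "inj_on (\<lambda>a. a \<oplus>\<^bsub>?V\<^esub> u) (fib s)"
        using u by (auto simp: inj_on_def fib_def)
      have "s \<oplus> (t \<ominus> s) = t" using st by algebra
      then show "(\<lambda>a. a \<oplus>\<^bsub>?V\<^esub> u) ` fib s \<subseteq> fib t"
        using u r by (auto simp: fib_def dot_add_left)
    qed (rule fin)
  qed
  have "carrier ?V = (\<Union>s\<in>carrier F. fib s)"
    using r by (auto simp: fib_def)
  then have "order F ^ Suc m = card (\<Union>s\<in>carrier F. fib s)"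
    using card_vec[of "Suc m"] by simp
  also have "\<dots> = (\<Sum>s\<in>carrier F. card (fib s))"
    by (rule card_UN_disjoint) (auto simp: finite_carrier fin, auto simp: fib_def)
  also have "\<dots> = order F * card (fib t)"
    using sum.cong[OF refl, of "carrier F" "\<lambda>s. card (fib s)" "\<lambda>_. card (fib t)"] le t
    by (simp add: order_def le_antisym)
  finally show ?thesis
    using order_gt_1 by (simp add: fib_def)
qed

lemma dot_annihilator_proportional:
  assumes r: "r \<in> carrier (vec m)" "r \<noteq> \<zero>\<^bsub>vec m\<^esub>" and r': "r' \<in> carrier (vec m)"
    and imp: "\<And>a. a \<in> carrier (vec m) \<Longrightarrow> dot m a r = \<zero> \<Longrightarrow> dot m a r' = \<zero>"
  obtains c where "c \<in> carrier F" "r' = c \<odot>\<^bsub>vec m\<^esub> r"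
proof -
  obtain i where i: "i < m" "r i \<noteq> \<zero>"
    using vec_nonzero_coord r by blast
  have ri: "r i \<in> carrier F" "r' i \<in> carrier F" using i r r' by auto
  then have inv: "inv (r i) \<in> carrier F" "r i \<otimes> inv (r i) = \<one>"
    using i field_Units by auto
  have "r' j = (r' i \<otimes> inv (r i)) \<otimes> r j" if j: "j < m" for j
  proof -
    have rj: "r j \<in> carrier F" "r' j \<in> carrier F" using j r r' by auto
    \<comment> \<open>The vector r_j e_i - r_i e_j is orthogonal to \<open>r\<close> by
      construction. Its product with \<open>r'\<close> must vanish too, which gives r_i r'_j = r_j
      r'_i and the factor r'_i / r_i.\<close>
    let ?a = "(r j \<odot>\<^bsub>vec m\<^esub> unit_vector m i) \<oplus>\<^bsub>vec m\<^esub> ((\<ominus> r i) \<odot>\<^bsub>vec m\<^esub> unit_vector m j)"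
    have dot_a: "dot m ?a x = r j \<otimes> x i \<oplus> (\<ominus> r i) \<otimes> x j" if "x \<in> carrier (vec m)" for x
      using that i j ri rj by (simp add: dot_add_left dot_smult_left)
    have "dot m ?a r = \<zero>"
      unfolding dot_a[OF r(1)] using ri rj by algebra
    moreover have "?a \<in> carrier (vec m)" using ri rj by simp
    ultimately have "r j \<otimes> r' i \<oplus> (\<ominus> r i) \<otimes> r' j = \<zero>"
      using imp dot_a[OF r'] by metis
    then have *: "r i \<otimes> r' j = r j \<otimes> r' i"
      using ri rj minus_other_side[of "r j \<otimes> r' i" "r i \<otimes> r' j"]
      by (simp add: a_minus_def l_minus)
    have "r' j = (r i \<otimes> inv (r i)) \<otimes> r' j" using inv rj by simp
    also have "\<dots> = inv (r i) \<otimes> (r i \<otimes> r' j)" using inv(1) ri rj by algebra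
    also have "\<dots> = (r' i \<otimes> inv (r i)) \<otimes> r j"
      unfolding * using inv(1) ri rj by algebra
    finally show ?thesis .
  qed
  then have "r' = (r' i \<otimes> inv (r i)) \<odot>\<^bsub>vec m\<^esub> r"
    using r r' ri inv by (intro vec_eqI[of _ m]) auto
  then show thesis using that ri inv by (metis m_closed)
qed

section \<open>Projective points and plane ovals\<close>

lemma subspace_carrier: "subspace F (carrier (vec m)) (vec m)"
  by (simp add: subspace_vec_iff)

lemma subspace_finite: "subspace F W (vec m) \<Longrightarrow> finite W"
  using finite_vec[of m] finite_subset by (auto simp: subspace_vec_iff)

lemma vec_smult_assoc:
  "c \<in> carrier F \<Longrightarrow> d \<in> carrier F \<Longrightarrow> x \<in> carrier (vec m) \<Longrightarrow>
    c \<odot>\<^bsub>vec m\<^esub> (d \<odot>\<^bsub>vec m\<^esub> x) = (c \<otimes> d) \<odot>\<^bsub>vec m\<^esub> x"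
  using module.smult_assoc1[OF vec_module] by metis

lemma vec_smult_one [simp]: "x \<in> carrier (vec m) \<Longrightarrow> \<one> \<odot>\<^bsub>vec m\<^esub> x = x"
  using module.smult_one[OF vec_module] by metis

lemma vec_smult_zero [simp]: "x \<in> carrier (vec m) \<Longrightarrow> \<zero> \<odot>\<^bsub>vec m\<^esub> x = \<zero>\<^bsub>vec m\<^esub>"
  using module.smult_l_null[OF vec_module] by metis

lemma vec_smult_zero_right [simp]: "c \<in> carrier F \<Longrightarrow> c \<odot>\<^bsub>vec m\<^esub> \<zero>\<^bsub>vec m\<^esub> = \<zero>\<^bsub>vec m\<^esub>"
  by (rule vec_eqI[of _ m]) auto

lemma vec_add_zero [simp]: "x \<in> carrier (vec m) \<Longrightarrow> x \<oplus>\<^bsub>vec m\<^esub> \<zero>\<^bsub>vec m\<^esub> = x"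
  "x \<in> carrier (vec m) \<Longrightarrow> \<zero>\<^bsub>vec m\<^esub> \<oplus>\<^bsub>vec m\<^esub> x = x"
  by (rule vec_eqI[of _ m]; auto)+

text \<open>For nonzero \<open>x\<close> this is the projective point spanned by \<open>x\<close>,
  not a projective line.\<close>

definition line :: "nat \<Rightarrow> (nat \<Rightarrow> 'a) \<Rightarrow> (nat \<Rightarrow> 'a) set"
  where "line m x = (\<lambda>c. c \<odot>\<^bsub>vec m\<^esub> x) ` carrier F"

lemma card_line:
  assumes "x \<in> carrier (vec m)" "x \<noteq> \<zero>\<^bsub>vec m\<^esub>"
  shows "card (line m x) = order F"
  unfolding line_def order_def
  by (rule card_image) (auto intro!: inj_onI vec_smult_cancel[OF assms])

lemma subspace_card_order_eq_line:
  assumes "subspace F P (vec m)" "card P = order F" "x \<in> P" "x \<noteq> \<zero>\<^bsub>vec m\<^esub>"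
  shows "P = line m x"
proof -
  have "line m x \<subseteq> P" "x \<in> carrier (vec m)"
    using assms by (auto simp: line_def subspace_vec_iff)
  then show ?thesis
    using card_subset_eq[OF subspace_finite[OF assms(1)], of "line m x"] card_line assms by simp
qed

lemma point_iff: "P \<in> pg_subspaces F N 0 \<longleftrightarrow> subspace F P (vec (Suc N)) \<and> card P = order F"
  by (simp add: pg_subspaces_iff)

lemma subspace_nonzero:
  assumes "subspace F P (vec m)" "card P > 1"
  obtains x where "x \<in> P" "x \<noteq> \<zero>\<^bsub>vec m\<^esub>"
proof -
  have "\<not> P \<subseteq> {\<zero>\<^bsub>vec m\<^esub>}"
    using assms(2) card_mono[of "{\<zero>\<^bsub>vec m\<^esub>}" P] by auto
  then show thesis using that by auto
qed

text \<open>The size of \<open>W\<close> is q^k with k at most 3. For k = 2, \<open>W\<close> would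
  be a projective line through three points of the oval; for k at most 1, it has no room for two
  distinct points.\<close>

lemma oval_span_eq:
  assumes B: "oval F 2 \<pi> B" and PQR: "P \<in> B" "Q \<in> B" "R \<in> B" "P \<noteq> Q" "P \<noteq> R" "Q \<noteq> R"
    and W: "subspace F W (vec 3)" "P \<subseteq> W" "Q \<subseteq> W" "R \<subseteq> W"
  shows "W = carrier (vec 3)"
proof -
  have B1: "X \<in> pg_subspaces F 2 0" if "X \<in> B" for X
    using B that by (auto simp: oval_def)
  obtain k where k: "card W = order F ^ k"
    using card_subspace[OF W(1)] by blast
  have W_sub: "W \<subseteq> carrier (vec 3)" using W by (simp add: subspace_vec_iff)
  have "order F ^ k \<le> order F ^ 3"
    using card_mono[OF finite_vec W_sub] k card_vec by simp
  then have "k \<le> 3" using order_gt_1 by simp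
  moreover have "k \<noteq> 2"
  proof
    assume "k = 2"
    then have "W \<in> pg_subspaces F 2 1"
      using W k by (simp add: pg_subspaces_iff eval_nat_numeral)
    moreover have "\<not> (\<exists>l\<in>pg_subspaces F 2 1. P \<subseteq> l \<and> Q \<subseteq> l \<and> R \<subseteq> l)"
      by (rule B[unfolded oval_def, THEN conjunct2, THEN conjunct2, THEN conjunct2, rule_format, OF PQR])
    ultimately show False using W(2-4) by blast
  qed
  moreover have False if "k \<le> 1"
  proof -
    have "card W \<le> order F"
      using k that order_gt_1 power_increasing[of k 1 "order F"] by simp
    then have "P = W" "Q = W"
      using card_seteq[OF subspace_finite[OF W(1)]] W B1 PQR by (auto simp: point_iff)
    then show False using PQR by simp
  qed
  ultimately have "k = 3" by force
  then show ?thesis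
    using k card_vec[of 3] card_subset_eq[OF finite_vec W_sub] by simp
qed

lemma oval_three_points:
  assumes "oval F N \<pi> B"
  obtains P Q R where "P \<in> B" "Q \<in> B" "R \<in> B" "P \<noteq> Q" "P \<noteq> R" "Q \<noteq> R"
proof -
  have "3 \<le> card B" using assms order_gt_1 by (simp add: oval_def)
  then obtain C where "C \<subseteq> B" "card C = 3"
    by (metis obtain_subset_with_card_n)
  then obtain P Q R where "{P, Q, R} \<subseteq> B" "P \<noteq> Q" "P \<noteq> R" "Q \<noteq> R"
    unfolding card_3_iff by metis
  then show thesis using that[of P Q R] by simp
qed

lemma subspace_dot_kernel:
  assumes "d \<in> carrier (vec m)"
  shows "subspace F {x \<in> carrier (vec m). dot m d x = \<zero>} (vec m)"
  using assms by (auto simp: subspace_vec_iff dot_add_right dot_smult_right)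

text \<open>The kernel of the functional given by \<open>a - b\<close> contains three points of the
  oval and is therefore everything. In the cone this recovers a plane from the points in its
  section.\<close>

lemma oval_dot_cancel:
  assumes B: "oval F 2 \<pi> B" and ab: "a \<in> carrier (vec 3)" "b \<in> carrier (vec 3)"
    and eq: "\<And>P x. P \<in> B \<Longrightarrow> x \<in> P \<Longrightarrow> dot 3 a x = dot 3 b x"
  shows "a = b"
proof -
  define d where "d = a \<oplus>\<^bsub>vec 3\<^esub> ((\<ominus> \<one>) \<odot>\<^bsub>vec 3\<^esub> b)"
  have d: "d \<in> carrier (vec 3)" using ab by (simp add: d_def)
  have dot_d: "dot 3 d x = dot 3 a x \<ominus> dot 3 b x" if "x \<in> carrier (vec 3)" for x
    using ab that unfolding d_def
    by (simp add: dot_add_left dot_smult_left) (simp add: a_minus_def l_minus)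
  obtain P Q R where PQR: "P \<in> B" "Q \<in> B" "R \<in> B" "P \<noteq> Q" "P \<noteq> R" "Q \<noteq> R"
    using oval_three_points[OF B] .
  have sub: "X \<subseteq> {x \<in> carrier (vec 3). dot 3 d x = \<zero>}" if "X \<in> B" for X
  proof -
    have "X \<subseteq> carrier (vec 3)"
      using B that by (auto simp: oval_def point_iff subspace_vec_iff numeral_3_eq_3 numeral_2_eq_2)
    moreover have "dot 3 b x \<ominus> dot 3 b x = \<zero>" if "x \<in> carrier (vec 3)" for x
      using that ab by simp
    ultimately show ?thesis using eq[OF that] dot_d by auto
  qed
  have kernel: "{x \<in> carrier (vec 3). dot 3 d x = \<zero>} = carrier (vec 3)"
    by (rule oval_span_eq[OF B PQR subspace_dot_kernel[OF d]]) (use sub PQR in auto)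
  then have "dot 3 a x \<ominus> dot 3 b x = \<zero>" if "x \<in> carrier (vec 3)" for x
    using dot_d[OF that] that kernel by (metis (mono_tags, lifting) mem_Collect_eq)
  then show ?thesis
    using ab by (intro dot_left_cancel[of a 3 b]) auto
qed

text \<open>A fixed generator of each point turns the value of a functional at that point into a
  scalar. Another choice would merely rescale the parameter \<open>t\<close> on that line of the
  model.\<close>

definition rep :: "(nat \<Rightarrow> 'a) set \<Rightarrow> nat \<Rightarrow> 'a"
  where "rep P = (SOME x. x \<in> P \<and> x \<noteq> \<zero>\<^bsub>vec 3\<^esub>)"

lemma rep:
  assumes "P \<in> pg_subspaces F 2 0"
  shows "rep P \<in> P" "rep P \<noteq> \<zero>\<^bsub>vec 3\<^esub>" "rep P \<in> carrier (vec 3)" "P = line 3 (rep P)"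
proof -
  have P: "subspace F P (vec 3)" "card P = order F"
    using assms by (auto simp: point_iff numeral_3_eq_3 numeral_2_eq_2)
  then have "\<exists>x. x \<in> P \<and> x \<noteq> \<zero>\<^bsub>vec 3\<^esub>"
    using subspace_nonzero order_gt_1 by metis
  then have "rep P \<in> P \<and> rep P \<noteq> \<zero>\<^bsub>vec 3\<^esub>"
    unfolding rep_def by (rule someI_ex)
  then show "rep P \<in> P" "rep P \<noteq> \<zero>\<^bsub>vec 3\<^esub>" by auto
  then show "P = line 3 (rep P)" using subspace_card_order_eq_line P by blast
  show "rep P \<in> carrier (vec 3)" using \<open>rep P \<in> P\<close> P by (auto simp: subspace_vec_iff)
qed

end

section \<open>Isomorphisms of incidence structures\<close>

lemma isomorphic_sym:
  assumes "isomorphic L M"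
  shows "isomorphic M L"
proof -
  obtain f g h where iso: "isomorphism L M f g h"
    using assms by (auto simp: isomorphic_def)
  let ?f = "inv_into (Points L) f" and ?g = "inv_into (Lines L) g" and ?h = "inv_into (Circles L) h"
  have "isomorphism M L ?f ?g ?h"
    unfolding isomorphism_def
  proof (intro conjI ballI)
    show "bij_betw ?f (Points M) (Points L)" "bij_betw ?g (Lines M) (Lines L)"
      "bij_betw ?h (Circles M) (Circles L)"
      using iso by (auto simp: isomorphism_def bij_betw_inv_into)
  next
    fix P l assume "P \<in> Points M" "l \<in> Lines M"
    then have "?f P \<in> Points L" "?g l \<in> Lines L" "f (?f P) = P" "g (?g l) = l"
      using iso by (auto simp: isomorphism_def bij_betw_inv_into_right bij_betw_def inv_into_into)
    then show "on_line L (?f P) (?g l) = on_line M P l"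
      using iso unfolding isomorphism_def by metis
  next
    fix P C assume "P \<in> Points M" "C \<in> Circles M"
    then have "?f P \<in> Points L" "?h C \<in> Circles L" "f (?f P) = P" "h (?h C) = C"
      using iso by (auto simp: isomorphism_def bij_betw_inv_into_right bij_betw_def inv_into_into)
    then show "on_circle L (?f P) (?h C) = on_circle M P C"
      using iso unfolding isomorphism_def by metis
  qed
  then show ?thesis by (auto simp: isomorphic_def)
qed

lemma isomorphic_trans:
  assumes "isomorphic L M" "isomorphic M N"
  shows "isomorphic L N"
proof -
  obtain f g h f' g' h' where iso: "isomorphism L M f g h" "isomorphism M N f' g' h'"
    using assms by (auto simp: isomorphic_def)
  have "isomorphism L N (f' \<circ> f) (g' \<circ> g) (h' \<circ> h)"
    unfolding isomorphism_def
  proof (intro conjI ballI)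
    show "bij_betw (f' \<circ> f) (Points L) (Points N)" "bij_betw (g' \<circ> g) (Lines L) (Lines N)"
      "bij_betw (h' \<circ> h) (Circles L) (Circles N)"
      using iso by (auto simp: isomorphism_def intro: bij_betw_trans)
  next
    fix P l assume "P \<in> Points L" "l \<in> Lines L"
    moreover from this have "f P \<in> Points M" "g l \<in> Lines M"
      using iso by (auto simp: isomorphism_def bij_betw_def)
    ultimately show "on_line N ((f' \<circ> f) P) ((g' \<circ> g) l) = on_line L P l"
      using iso by (simp add: isomorphism_def)
  next
    fix P C assume "P \<in> Points L" "C \<in> Circles L"
    moreover from this have "f P \<in> Points M" "h C \<in> Circles M"
      using iso by (auto simp: isomorphism_def bij_betw_def)
    ultimately show "on_circle N ((f' \<circ> f) P) ((h' \<circ> h) C) = on_circle L P C"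
      using iso by (simp add: isomorphism_def)
  qed
  then show ?thesis by (auto simp: isomorphic_def)
qed

section \<open>The coordinate model of an oval\<close>

context finite_field
begin

lemma field_inverse:
  assumes "c \<in> carrier F" "c \<noteq> \<zero>"
  shows "inv c \<in> carrier F" "inv c \<otimes> c = \<one>" "c \<otimes> inv c = \<one>"
  using assms field_Units by auto

lemma line_closed: "x \<in> carrier (vec m) \<Longrightarrow> line m x \<subseteq> carrier (vec m)"
  by (auto simp: line_def)

lemma line_self: "x \<in> carrier (vec m) \<Longrightarrow> x \<in> line m x"
  unfolding line_def by (rule image_eqI[of _ _ \<one>]) auto

lemma subspace_line:
  assumes "x \<in> carrier (vec m)"
  shows "subspace F (line m x) (vec m)"
proof -
  have "\<zero>\<^bsub>vec m\<^esub> \<in> line m x"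
    unfolding line_def using assms by (intro image_eqI[of _ _ \<zero>]) auto
  moreover have "c \<odot>\<^bsub>vec m\<^esub> x \<oplus>\<^bsub>vec m\<^esub> d \<odot>\<^bsub>vec m\<^esub> x = (c \<oplus> d) \<odot>\<^bsub>vec m\<^esub> x"
    if "c \<in> carrier F" "d \<in> carrier F" for c d
    using module.smult_l_distr[OF vec_module] that assms by metis
  then have "\<forall>y\<in>line m x. \<forall>z\<in>line m x. y \<oplus>\<^bsub>vec m\<^esub> z \<in> line m x"
    unfolding line_def by (auto intro!: imageI)
  moreover have "\<forall>c\<in>carrier F. \<forall>y\<in>line m x. c \<odot>\<^bsub>vec m\<^esub> y \<in> line m x"
    unfolding line_def using assms by (auto simp: vec_smult_assoc intro!: imageI)
  ultimately show ?thesis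
    using line_closed[OF assms] by (simp add: subspace_vec_iff)
qed

lemma line_subset_iff:
  "subspace F W (vec m) \<Longrightarrow> x \<in> carrier (vec m) \<Longrightarrow> line m x \<subseteq> W \<longleftrightarrow> x \<in> W"
  using line_self[of x m] by (auto simp: line_def subspace_vec_iff)

lemma point_eqI:
  assumes "P \<in> pg_subspaces F 2 0" "Q \<in> pg_subspaces F 2 0" and "rep P \<in> Q"
  shows "P = Q"
proof -
  have "Q = line 3 (rep P)"
    using subspace_card_order_eq_line[of Q 3 "rep P"] assms rep[OF assms(1)]
    by (simp add: point_iff eval_nat_numeral)
  then show ?thesis using rep(4)[OF assms(1)] by simp
qed

text \<open>Inclusion suffices because the annihilators of two nonzero vectors are hyperplanes: the
  representative of \<open>Q\<close> is a multiple of that of \<open>P\<close>.\<close>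

lemma point_eq_annihilatorI:
  assumes P: "P \<in> pg_subspaces F 2 0" and Q: "Q \<in> pg_subspaces F 2 0"
    and imp: "\<And>a. a \<in> carrier (vec 3) \<Longrightarrow> dot 3 a (rep P) = \<zero> \<Longrightarrow> dot 3 a (rep Q) = \<zero>"
  shows "P = Q"
proof -
  obtain c where "c \<in> carrier F" "rep Q = c \<odot>\<^bsub>vec 3\<^esub> rep P"
    using dot_annihilator_proportional[of "rep P" 3 "rep Q"] rep[OF P] rep[OF Q] imp by metis
  then have "rep Q \<in> line 3 (rep P)" by (auto simp: line_def)
  then show ?thesis
    using point_eqI[OF Q P] rep(4)[OF P] by metis
qed

text \<open>With the oval as abscissa and \<open>t\<close> as ordinate, a line is a vertical fibre
  and a circle is the graph of a linear functional evaluated at the chosen representatives.\<close>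

definition oval_plane ::
  "(nat \<Rightarrow> 'a) set set \<Rightarrow> ((nat \<Rightarrow> 'a) set \<times> 'a, (nat \<Rightarrow> 'a) set, nat \<Rightarrow> 'a) plc_structure"
  where "oval_plane B =
    \<lparr>Points = B \<times> carrier F,
     Lines = B,
     Circles = carrier (vec 3),
     on_line = (\<lambda>p l. fst p = l),
     on_circle = (\<lambda>p a. dot 3 a (rep (fst p)) = snd p)\<rparr>"

end

section \<open>Affine coordinates in a projective space and the structure at its hyperplane\<close>

text \<open>\<open>F\<close> acts on K^3 through \<open>\<phi>\<close>, so \<open>\<Theta>\<close>
  is an \<open>F\<close>-linear bijection. Keeping the two fields apart lets the same facts serve
  twice: for the dual structure with \<open>N = 3 * n + 1\<close>, and for the cone with both fields
  equal, \<open>\<phi>\<close> the identity and \<open>N = 4\<close>.\<close>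

locale semilinear_splitting = K: finite_field K + F: finite_field F
  for K :: "'a ring" and F :: "'b ring" +
  fixes \<phi> :: "'b \<Rightarrow> 'a" and N :: nat and \<Theta> :: "(nat \<Rightarrow> 'a) \<Rightarrow> 'b \<Rightarrow> nat \<Rightarrow> 'b"
  assumes \<phi>_hom: "\<phi> \<in> ring_hom F K"
    and \<Theta>_bij: "bij_betw (\<lambda>(a, z). \<Theta> a z) (carrier (K.vec 3) \<times> carrier F) (carrier (F.vec N))"
    and \<Theta>_add: "\<lbrakk>a \<in> carrier (K.vec 3); b \<in> carrier (K.vec 3); z \<in> carrier F; w \<in> carrier F\<rbrakk> \<Longrightarrow>
      \<Theta> (a \<oplus>\<^bsub>K.vec 3\<^esub> b) (z \<oplus>\<^bsub>F\<^esub> w) = \<Theta> a z \<oplus>\<^bsub>F.vec N\<^esub> \<Theta> b w"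
    and \<Theta>_smult: "\<lbrakk>c \<in> carrier F; a \<in> carrier (K.vec 3); z \<in> carrier F\<rbrakk> \<Longrightarrow>
      \<Theta> (\<phi> c \<odot>\<^bsub>K.vec 3\<^esub> a) (c \<otimes>\<^bsub>F\<^esub> z) = c \<odot>\<^bsub>F.vec N\<^esub> \<Theta> a z"
begin

sublocale \<phi>: ring_hom_cring F K \<phi>
  by unfold_locales (rule \<phi>_hom)

lemma \<Theta>_closed [simp]:
  "a \<in> carrier (K.vec 3) \<Longrightarrow> z \<in> carrier F \<Longrightarrow> \<Theta> a z \<in> carrier (F.vec N)"
  using \<Theta>_bij by (auto simp: bij_betw_def)

lemma \<Theta>_eq_iff [simp]:
  "\<lbrakk>a \<in> carrier (K.vec 3); z \<in> carrier F; b \<in> carrier (K.vec 3); w \<in> carrier F\<rbrakk> \<Longrightarrow>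
    \<Theta> a z = \<Theta> b w \<longleftrightarrow> a = b \<and> z = w"
  using \<Theta>_bij by (auto simp: bij_betw_def inj_on_def)

lemma \<Theta>_cases:
  assumes "x \<in> carrier (F.vec N)"
  obtains a z where "a \<in> carrier (K.vec 3)" "z \<in> carrier F" "x = \<Theta> a z"
proof -
  have "x \<in> (\<lambda>(a, z). \<Theta> a z) ` (carrier (K.vec 3) \<times> carrier F)"
    using assms \<Theta>_bij by (simp add: bij_betw_def)
  then show thesis using that by auto
qed

lemma \<Theta>_zero: "\<Theta> \<zero>\<^bsub>K.vec 3\<^esub> \<zero>\<^bsub>F\<^esub> = \<zero>\<^bsub>F.vec N\<^esub>"
  using \<Theta>_smult[of "\<zero>\<^bsub>F\<^esub>" "\<zero>\<^bsub>K.vec 3\<^esub>" "\<zero>\<^bsub>F\<^esub>"] by simp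

text \<open>The concrete subspaces below are all images of sets of pairs, so that membership,
  closure and size can be checked on the pairs.\<close>

definition im :: "((nat \<Rightarrow> 'a) \<times> 'b) set \<Rightarrow> (nat \<Rightarrow> 'b) set"
  where "im U = (\<lambda>(a, z). \<Theta> a z) ` U"

lemma \<Theta>_in_im_iff:
  "\<lbrakk>U \<subseteq> carrier (K.vec 3) \<times> carrier F; a \<in> carrier (K.vec 3); z \<in> carrier F\<rbrakk> \<Longrightarrow>
    \<Theta> a z \<in> im U \<longleftrightarrow> (a, z) \<in> U"
  by (force simp: im_def)

lemma card_im: "U \<subseteq> carrier (K.vec 3) \<times> carrier F \<Longrightarrow> card (im U) = card U"
  unfolding im_def using \<Theta>_bij by (intro card_image) (auto simp: bij_betw_def intro: inj_on_subset)

lemma subspace_im: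
  assumes U: "U \<subseteq> carrier (K.vec 3) \<times> carrier F"
    and zero: "(\<zero>\<^bsub>K.vec 3\<^esub>, \<zero>\<^bsub>F\<^esub>) \<in> U"
    and add: "\<And>a z b w. (a, z) \<in> U \<Longrightarrow> (b, w) \<in> U \<Longrightarrow> (a \<oplus>\<^bsub>K.vec 3\<^esub> b, z \<oplus>\<^bsub>F\<^esub> w) \<in> U"
    and smult: "\<And>c a z. c \<in> carrier F \<Longrightarrow> (a, z) \<in> U \<Longrightarrow> (\<phi> c \<odot>\<^bsub>K.vec 3\<^esub> a, c \<otimes>\<^bsub>F\<^esub> z) \<in> U"
  shows "subspace F (im U) (F.vec N)"
  unfolding F.subspace_vec_iff
proof (intro conjI ballI)
  show "im U \<subseteq> carrier (F.vec N)"
    using U by (auto simp: im_def)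
  show "\<zero>\<^bsub>F.vec N\<^esub> \<in> im U"
    unfolding im_def using zero by (intro image_eqI[of _ _ "(\<zero>\<^bsub>K.vec 3\<^esub>, \<zero>\<^bsub>F\<^esub>)"]) (auto simp: \<Theta>_zero)
next
  fix x y assume "x \<in> im U" "y \<in> im U"
  then obtain a z b w where "x = \<Theta> a z" "y = \<Theta> b w" "(a, z) \<in> U" "(b, w) \<in> U"
    by (auto simp: im_def)
  moreover from this have "x \<oplus>\<^bsub>F.vec N\<^esub> y = \<Theta> (a \<oplus>\<^bsub>K.vec 3\<^esub> b) (z \<oplus>\<^bsub>F\<^esub> w)"
    using U by (subst \<Theta>_add) auto
  ultimately show "x \<oplus>\<^bsub>F.vec N\<^esub> y \<in> im U"
    using add unfolding im_def by (auto intro!: image_eqI[of _ _ "(a \<oplus>\<^bsub>K.vec 3\<^esub> b, z \<oplus>\<^bsub>F\<^esub> w)"])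
next
  fix c x assume "c \<in> carrier F" "x \<in> im U"
  then obtain a z where "x = \<Theta> a z" "(a, z) \<in> U"
    by (auto simp: im_def)
  moreover from this have "c \<odot>\<^bsub>F.vec N\<^esub> x = \<Theta> (\<phi> c \<odot>\<^bsub>K.vec 3\<^esub> a) (c \<otimes>\<^bsub>F\<^esub> z)"
    using U \<open>c \<in> carrier F\<close> by (subst \<Theta>_smult) auto
  ultimately show "c \<odot>\<^bsub>F.vec N\<^esub> x \<in> im U"
    using smult \<open>c \<in> carrier F\<close> unfolding im_def
    by (auto intro!: image_eqI[of _ _ "(\<phi> c \<odot>\<^bsub>K.vec 3\<^esub> a, c \<otimes>\<^bsub>F\<^esub> z)"])
qed

text \<open>This homogenises the affine equation saying that \<open>a\<close> has value
  \<open>t\<close> at \<open>rep P\<close>, with \<open>z\<close> as the homogenising coordinate. If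
  \<open>K\<close> has degree \<open>n\<close> over \<open>F\<close>, the single
  \<open>K\<close>-valued equation cuts the vector dimension from 3n+1 to 2n+1. At
  \<open>z = 0\<close> the parameter \<open>t\<close> disappears and \<open>annihilator P\<close>
  remains.\<close>

definition affine_plane :: "(nat \<Rightarrow> 'a) set \<times> 'a \<Rightarrow> (nat \<Rightarrow> 'b) set"
  where "affine_plane p = im {(a, z). a \<in> carrier (K.vec 3) \<and> z \<in> carrier F \<and>
    K.dot 3 a (K.rep (fst p)) = \<phi> z \<otimes>\<^bsub>K\<^esub> snd p}"

definition annihilator :: "(nat \<Rightarrow> 'a) set \<Rightarrow> (nat \<Rightarrow> 'b) set"
  where "annihilator P = im ({a \<in> carrier (K.vec 3). K.dot 3 a (K.rep P) = \<zero>\<^bsub>K\<^esub>} \<times> {\<zero>\<^bsub>F\<^esub>})"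

lemma in_affine_plane_iff:
  "a \<in> carrier (K.vec 3) \<Longrightarrow> z \<in> carrier F \<Longrightarrow>
    \<Theta> a z \<in> affine_plane p \<longleftrightarrow> K.dot 3 a (K.rep (fst p)) = \<phi> z \<otimes>\<^bsub>K\<^esub> snd p"
  unfolding affine_plane_def by (subst \<Theta>_in_im_iff) auto

lemma in_annihilator_iff:
  "a \<in> carrier (K.vec 3) \<Longrightarrow> z \<in> carrier F \<Longrightarrow>
    \<Theta> a z \<in> annihilator P \<longleftrightarrow> K.dot 3 a (K.rep P) = \<zero>\<^bsub>K\<^esub> \<and> z = \<zero>\<^bsub>F\<^esub>"
  unfolding annihilator_def by (subst \<Theta>_in_im_iff) auto

lemma annihilator_subset_imp_eq:
  assumes "P \<in> pg_subspaces K 2 0" "Q \<in> pg_subspaces K 2 0" "annihilator P \<subseteq> annihilator Q"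
  shows "P = Q"
proof (rule K.point_eq_annihilatorI[OF assms(1,2)])
  fix a assume "a \<in> carrier (K.vec 3)" "K.dot 3 a (K.rep P) = \<zero>\<^bsub>K\<^esub>"
  then show "K.dot 3 a (K.rep Q) = \<zero>\<^bsub>K\<^esub>"
    using in_annihilator_iff[of a "\<zero>\<^bsub>F\<^esub>"] assms(3) by auto
qed

lemma subspace_affine_plane:
  assumes P: "P \<in> pg_subspaces K 2 0" and t: "t \<in> carrier K"
  shows "subspace F (affine_plane (P, t)) (F.vec N)"
  unfolding affine_plane_def
proof (rule subspace_im)
  note [simp] = K.rep(3)[OF P] t
  fix a z b w c
  assume az: "(a, z) \<in> {(a, z). a \<in> carrier (K.vec 3) \<and> z \<in> carrier F \<and>
      K.dot 3 a (K.rep (fst (P, t))) = \<phi> z \<otimes>\<^bsub>K\<^esub> snd (P, t)}"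
  {
    assume "(b, w) \<in> {(a, z). a \<in> carrier (K.vec 3) \<and> z \<in> carrier F \<and>
      K.dot 3 a (K.rep (fst (P, t))) = \<phi> z \<otimes>\<^bsub>K\<^esub> snd (P, t)}"
    then show "(a \<oplus>\<^bsub>K.vec 3\<^esub> b, z \<oplus>\<^bsub>F\<^esub> w) \<in> {(a, z). a \<in> carrier (K.vec 3) \<and> z \<in> carrier F \<and>
      K.dot 3 a (K.rep (fst (P, t))) = \<phi> z \<otimes>\<^bsub>K\<^esub> snd (P, t)}"
      using az by (simp add: K.dot_add_left K.l_distr)
  next
    assume "c \<in> carrier F"
    then show "(\<phi> c \<odot>\<^bsub>K.vec 3\<^esub> a, c \<otimes>\<^bsub>F\<^esub> z) \<in> {(a, z). a \<in> carrier (K.vec 3) \<and> z \<in> carrier F \<and>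
      K.dot 3 a (K.rep (fst (P, t))) = \<phi> z \<otimes>\<^bsub>K\<^esub> snd (P, t)}"
      using az by (simp add: K.dot_smult_left K.m_assoc)
  }
next
  have "K.dot 3 \<zero>\<^bsub>K.vec 3\<^esub> (K.rep P) = \<zero>\<^bsub>K\<^esub>"
    using K.rep(3)[OF P] by (simp add: K.dot_comm[of "\<zero>\<^bsub>K.vec 3\<^esub>"])
  then show "(\<zero>\<^bsub>K.vec 3\<^esub>, \<zero>\<^bsub>F\<^esub>) \<in> {(a, z). a \<in> carrier (K.vec 3) \<and> z \<in> carrier F \<and>
      K.dot 3 a (K.rep (fst (P, t))) = \<phi> z \<otimes>\<^bsub>K\<^esub> snd (P, t)}"
    using t by simp
qed auto

text \<open>For each \<open>z\<close> the admissible \<open>a\<close> form one fibre of the scalar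
  product with \<open>rep P\<close>, of size |K|^2 whatever \<open>z\<close> is.\<close>

lemma card_affine_plane:
  assumes P: "P \<in> pg_subspaces K 2 0" and t: "t \<in> carrier K"
  shows "card (affine_plane (P, t)) = order F * order K ^ 2"
proof -
  let ?fib = "\<lambda>z. {a \<in> carrier (K.vec 3). K.dot 3 a (K.rep P) = \<phi> z \<otimes>\<^bsub>K\<^esub> t}"
  let ?U = "{(a, z). a \<in> carrier (K.vec 3) \<and> z \<in> carrier F \<and> K.dot 3 a (K.rep P) = \<phi> z \<otimes>\<^bsub>K\<^esub> t}"
  have "card (affine_plane (P, t)) = card ?U"
    unfolding affine_plane_def by (subst card_im) auto
  also have "\<dots> = card (SIGMA z:carrier F. ?fib z)"
    by (rule bij_betw_same_card[of prod.swap]) (auto simp: bij_betw_def inj_on_def image_iff)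
  also have "\<dots> = (\<Sum>z\<in>carrier F. card (?fib z))"
    by (rule card_SigmaI) (auto simp: F.finite_carrier intro: finite_subset[OF _ K.finite_vec[of 3]])
  also have "\<dots> = (\<Sum>z\<in>carrier F. order K ^ 2)"
    using K.card_dot_fibre[of "K.rep P" 2] K.rep[OF P] t
    by (intro sum.cong refl) (simp add: eval_nat_numeral)
  finally show ?thesis by (simp add: order_def)
qed

lemma subset_subspace_eq:
  assumes "subspace F W (F.vec N)" "V \<subseteq> W" "card V = card W"
  shows "V = W"
  using card_subset_eq[OF F.subspace_finite[OF assms(1)] assms(2,3)] .

text \<open>The hypotheses \<open>hyperplane\<close> and \<open>lines\<close> carry all the
  information about the coordinate that vanishes at infinity and about \<open>D\<close>; the rest
  takes place on pairs \<open>(a, z)\<close>. An affine point is normalised to \<open>z = 1\<close>,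
  which identifies the circles with the vectors of K^3.\<close>

theorem oval_plane_isomorphic_L_structure:
  assumes N: "N = 3 * n + 1" and ord: "order K = order F ^ n" and B: "B \<subseteq> pg_subspaces K 2 0"
    and hyperplane: "hyperplane_at_infinity F n = im (carrier (K.vec 3) \<times> {\<zero>\<^bsub>F\<^esub>})"
    and lines: "at_infinity F n ` D = annihilator ` B"
  shows "isomorphic (K.oval_plane B) (L_structure F n D)"
proof -
  define point where "point a = F.line N (\<Theta> a \<one>\<^bsub>F\<^esub>)" for a
  have pg: "U \<in> pg_subspaces F (3 * n) d \<longleftrightarrow> subspace F U (F.vec N) \<and> card U = order F ^ (d + 1)"
    for U d using F.pg_subspaces_iff N by simp
  have in_hyperplane: "\<Theta> a z \<in> hyperplane_at_infinity F n \<longleftrightarrow> z = \<zero>\<^bsub>F\<^esub>"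
    if "a \<in> carrier (K.vec 3)" "z \<in> carrier F" for a z
    unfolding hyperplane by (subst \<Theta>_in_im_iff) (use that in auto)
  have card: "order F * order K ^ 2 = order F ^ (2 * n + 1)"
    unfolding ord by (simp add: power_mult mult.commute flip: power_mult)
  have meet: "affine_plane (P, t) \<inter> hyperplane_at_infinity F n = annihilator P"
    if "P \<in> B" "t \<in> carrier K" for P t
  proof -
    have "x \<in> affine_plane (P, t) \<inter> hyperplane_at_infinity F n \<longleftrightarrow> x \<in> annihilator P"
      if "x \<in> carrier (F.vec N)" for x
      using that
    proof (rule \<Theta>_cases)
      fix a z assume az: "a \<in> carrier (K.vec 3)" "z \<in> carrier F" "x = \<Theta> a z"
      show ?thesis
        unfolding az(3) Int_iff in_affine_plane_iff[OF az(1,2)] in_annihilator_iff[OF az(1,2)]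
          in_hyperplane[OF az(1,2)]
        using \<open>t \<in> carrier K\<close> by auto
    qed
    moreover have "affine_plane (P, t) \<subseteq> carrier (F.vec N)" "annihilator P \<subseteq> carrier (F.vec N)"
      by (auto simp: affine_plane_def annihilator_def im_def)
    ultimately show ?thesis by blast
  qed
  have \<Theta>_one: "\<Theta> a \<one>\<^bsub>F\<^esub> \<in> affine_plane (P, t) \<longleftrightarrow> K.dot 3 a (K.rep P) = t"
    if "a \<in> carrier (K.vec 3)" "t \<in> carrier K" for a P t
    using that by (subst in_affine_plane_iff) auto
  have point_sub: "point a \<subseteq> W \<longleftrightarrow> \<Theta> a \<one>\<^bsub>F\<^esub> \<in> W"
    if "a \<in> carrier (K.vec 3)" "subspace F W (F.vec N)" for a W
    unfolding point_def using that by (simp add: F.line_subset_iff)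
  have \<Theta>_one_nonzero: "\<Theta> a \<one>\<^bsub>F\<^esub> \<noteq> \<zero>\<^bsub>F.vec N\<^esub>" if "a \<in> carrier (K.vec 3)" for a
    using that by (simp flip: \<Theta>_zero)
  have card_pt: "subspace F (point a) (F.vec N)" "card (point a) = order F" if "a \<in> carrier (K.vec 3)" for a
    using that \<Theta>_one_nonzero F.subspace_line F.card_line by (auto simp: point_def)
  \<comment> \<open>A vector off the hyperplane has nonzero \<open>z\<close>, and dividing by
    \<open>z\<close> does not change the projective point that it spans.\<close>
  have scale: "F.line N x = F.line N (\<Theta> (\<phi> (inv\<^bsub>F\<^esub> z) \<odot>\<^bsub>K.vec 3\<^esub> a) \<one>\<^bsub>F\<^esub>)"
    and scale_in: "\<Theta> (\<phi> (inv\<^bsub>F\<^esub> z) \<odot>\<^bsub>K.vec 3\<^esub> a) \<one>\<^bsub>F\<^esub> \<in> F.line N x"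
    if "a \<in> carrier (K.vec 3)" "z \<in> carrier F" "z \<noteq> \<zero>\<^bsub>F\<^esub>" "x = \<Theta> a z" for a z x
  proof -
    have x: "x \<in> carrier (F.vec N)" "x \<noteq> \<zero>\<^bsub>F.vec N\<^esub>"
      using that by (auto simp flip: \<Theta>_zero)
    have "\<Theta> (\<phi> (inv\<^bsub>F\<^esub> z) \<odot>\<^bsub>K.vec 3\<^esub> a) \<one>\<^bsub>F\<^esub> = inv\<^bsub>F\<^esub> z \<odot>\<^bsub>F.vec N\<^esub> x"
      using \<Theta>_smult[of "inv\<^bsub>F\<^esub> z" a z] F.field_inverse that by simp
    then show in_line: "\<Theta> (\<phi> (inv\<^bsub>F\<^esub> z) \<odot>\<^bsub>K.vec 3\<^esub> a) \<one>\<^bsub>F\<^esub> \<in> F.line N x"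
      using F.field_inverse(1)[of z] that(2,3) by (simp add: F.line_def)
    show "F.line N x = F.line N (\<Theta> (\<phi> (inv\<^bsub>F\<^esub> z) \<odot>\<^bsub>K.vec 3\<^esub> a) \<one>\<^bsub>F\<^esub>)"
      using F.subspace_line[OF x(1)] F.card_line[OF x] in_line
      by (rule F.subspace_card_order_eq_line)
        (use \<Theta>_one_nonzero F.field_inverse(1)[of z] that in simp)
  qed
  have "isomorphism (K.oval_plane B) (L_structure F n D) affine_plane annihilator point"
    unfolding isomorphism_def
  proof (intro conjI ballI)
    show "bij_betw affine_plane (Points (K.oval_plane B)) (Points (L_structure F n D))"
    proof (rule bij_betw_imageI)
      show "inj_on affine_plane (Points (K.oval_plane B))"
      proof (rule inj_onI)
        fix p p' assume "p \<in> Points (K.oval_plane B)" "p' \<in> Points (K.oval_plane B)"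
          and eq: "affine_plane p = affine_plane p'"
        then obtain P t P' t' where p: "p = (P, t)" "p' = (P', t')" "P \<in> B" "P' \<in> B"
          "t \<in> carrier K" "t' \<in> carrier K"
          by (auto simp: K.oval_plane_def)
        then have "annihilator P = annihilator P'"
          using meet[of P t] meet[of P' t'] eq by simp
        then have "P = P'"
          using annihilator_subset_imp_eq p B by blast
        moreover have "t = t'"
        proof -
          \<comment> \<open>An affine point of the first subspace separates parameters: it lies in
            the second one as well, so its value at \<open>rep P\<close> is both \<open>t\<close>
            and \<open>t'\<close>.\<close>
          obtain a where a: "a \<in> carrier (K.vec 3)" "K.dot 3 a (K.rep P) = t"
            using K.dot_surj[of "K.rep P" 3 t] K.rep[of P] p B by blast
          then show ?thesis
            using \<Theta>_one[of a t P] \<Theta>_one[of a t' P'] eq p \<open>P = P'\<close> by simp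
        qed
        ultimately show "p = p'" using p by simp
      qed
      show "affine_plane ` Points (K.oval_plane B) = Points (L_structure F n D)"
      proof (intro equalityI subsetI)
        fix A assume "A \<in> affine_plane ` Points (K.oval_plane B)"
        then obtain P t where A: "A = affine_plane (P, t)" "P \<in> B" "t \<in> carrier K"
          by (auto simp: K.oval_plane_def)
        then have P: "P \<in> pg_subspaces K 2 0" using B by blast
        have "A \<in> pg_subspaces F (3 * n) (2 * n)"
          unfolding pg A(1) using subspace_affine_plane[OF P] card_affine_plane[OF P] A card by simp
        moreover have "A \<inter> hyperplane_at_infinity F n \<in> at_infinity F n ` D"
          unfolding A(1) lines meet[OF A(2,3)] using A(2) by (rule imageI)
        ultimately show "A \<in> Points (L_structure F n D)"
          by (simp add: L_structure_def)
      next
        fix A assume "A \<in> Points (L_structure F n D)"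
        then have A: "subspace F A (F.vec N)" "card A = order F ^ (2 * n + 1)"
          and "A \<inter> hyperplane_at_infinity F n \<in> annihilator ` B"
          by (auto simp: L_structure_def pg lines)
        then obtain P where P: "P \<in> B" "A \<inter> hyperplane_at_infinity F n = annihilator P"
          by blast
        have P': "P \<in> pg_subspaces K 2 0" using P B by blast
        \<comment> \<open>If \<open>A\<close> lay at infinity, it would equal
          \<open>annihilator P\<close>, which is contained in
          \<open>affine_plane (P, \<zero>)\<close>. Both have the same size, so they would be equal,
          but the latter contains vectors with \<open>z = 1\<close>.\<close>
        have "\<not> A \<subseteq> hyperplane_at_infinity F n"
        proof
          assume "A \<subseteq> hyperplane_at_infinity F n"
          then have "A \<subseteq> affine_plane (P, \<zero>\<^bsub>K\<^esub>)"
            using P(2) meet[OF P(1), of "\<zero>\<^bsub>K\<^esub>"] by blast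
          then have "A = affine_plane (P, \<zero>\<^bsub>K\<^esub>)"
            using subset_subspace_eq[OF subspace_affine_plane[OF P']] card_affine_plane[OF P'] A card
            by simp
          moreover obtain a where "a \<in> carrier (K.vec 3)" "K.dot 3 a (K.rep P) = \<zero>\<^bsub>K\<^esub>"
            using K.dot_surj[of "K.rep P" 3 "\<zero>\<^bsub>K\<^esub>"] K.rep[OF P'] by blast
          then have "\<Theta> a \<one>\<^bsub>F\<^esub> \<in> affine_plane (P, \<zero>\<^bsub>K\<^esub>)" "\<Theta> a \<one>\<^bsub>F\<^esub> \<notin> hyperplane_at_infinity F n"
            using \<Theta>_one[of a "\<zero>\<^bsub>K\<^esub>" P] in_hyperplane[of a "\<one>\<^bsub>F\<^esub>"] by auto
          ultimately show False
            using \<open>A \<subseteq> hyperplane_at_infinity F n\<close> by blast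
        qed
        then obtain x where x: "x \<in> A" "x \<notin> hyperplane_at_infinity F n" by blast
        then have "x \<in> carrier (F.vec N)"
          using A(1) by (auto simp: F.subspace_vec_iff)
        then obtain a z where az: "a \<in> carrier (K.vec 3)" "z \<in> carrier F" "x = \<Theta> a z"
          by (rule \<Theta>_cases)
        then have "z \<noteq> \<zero>\<^bsub>F\<^esub>" using x(2) in_hyperplane by blast
        define b where "b = \<phi> (inv\<^bsub>F\<^esub> z) \<odot>\<^bsub>K.vec 3\<^esub> a"
        have b: "b \<in> carrier (K.vec 3)"
          using az F.field_inverse(1)[OF az(2) \<open>z \<noteq> \<zero>\<^bsub>F\<^esub>\<close>] by (simp add: b_def)
        have "F.line N x \<subseteq> A"
          using F.line_subset_iff[OF A(1) \<open>x \<in> carrier (F.vec N)\<close>] x(1) by simp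
        then have b_in: "\<Theta> b \<one>\<^bsub>F\<^esub> \<in> A"
          using scale_in[OF az(1,2) \<open>z \<noteq> \<zero>\<^bsub>F\<^esub>\<close> az(3)] by (auto simp: b_def)
        \<comment> \<open>Since the normalised vector of \<open>b\<close> lies in \<open>A\<close>,
          its value at \<open>rep P\<close> is the only possible parameter.\<close>
        define t where "t = K.dot 3 b (K.rep P)"
        have t: "t \<in> carrier K" using b K.rep[OF P'] by (simp add: t_def)
        have "affine_plane (P, t) \<subseteq> A"
        proof
          fix y assume y: "y \<in> affine_plane (P, t)"
          then obtain c w where cw: "c \<in> carrier (K.vec 3)" "w \<in> carrier F" "y = \<Theta> c w"
            "K.dot 3 c (K.rep P) = \<phi> w \<otimes>\<^bsub>K\<^esub> t"
            by (auto simp: affine_plane_def im_def)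
          \<comment> \<open>The decomposition is (c, w) = (d, 0) + w (b, 1). Here
            \<open>d = c - w b\<close> has value zero at \<open>rep P\<close>, so the first summand
            lies in \<open>A\<close> at infinity, and the second is a multiple of the affine vector
            already found in \<open>A\<close>.\<close>
          define d where "d = c \<oplus>\<^bsub>K.vec 3\<^esub> (\<phi> (\<ominus>\<^bsub>F\<^esub> w) \<odot>\<^bsub>K.vec 3\<^esub> b)"
          have d: "d \<in> carrier (K.vec 3)" using cw b by (simp add: d_def)
          have "K.dot 3 d (K.rep P) = \<zero>\<^bsub>K\<^esub>"
            unfolding d_def using cw b K.rep[OF P'] t
            by (simp add: K.dot_add_left K.dot_smult_left t_def[symmetric] K.l_minus K.r_neg)
          then have "\<Theta> d \<zero>\<^bsub>F\<^esub> \<in> A"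
            using in_annihilator_iff[OF d, of "\<zero>\<^bsub>F\<^esub>" P] P(2) by auto
          moreover have "\<Theta> (\<phi> w \<odot>\<^bsub>K.vec 3\<^esub> b) w \<in> A"
            using \<Theta>_smult[OF cw(2) b, of "\<one>\<^bsub>F\<^esub>"] A(1) b_in cw by (simp add: F.subspace_vec_iff)
          ultimately have "\<Theta> (d \<oplus>\<^bsub>K.vec 3\<^esub> (\<phi> w \<odot>\<^bsub>K.vec 3\<^esub> b)) w \<in> A"
            using \<Theta>_add[of d "\<phi> w \<odot>\<^bsub>K.vec 3\<^esub> b" "\<zero>\<^bsub>F\<^esub>" w] A(1) d cw b by (simp add: F.subspace_vec_iff)
          moreover have "d \<oplus>\<^bsub>K.vec 3\<^esub> (\<phi> w \<odot>\<^bsub>K.vec 3\<^esub> b) = c"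
            by (rule K.vec_eqI[of _ 3])
              (use d cw b in \<open>auto simp: d_def K.l_minus K.a_assoc K.l_neg\<close>)
          ultimately show "y \<in> A" using cw by simp
        qed
        then have "affine_plane (P, t) = A"
          using subset_subspace_eq[OF A(1)] card_affine_plane[OF P' t] A card by simp
        then show "A \<in> affine_plane ` Points (K.oval_plane B)"
          using P t by (auto simp: K.oval_plane_def)
      qed
    qed
  next
    show "bij_betw annihilator (Lines (K.oval_plane B)) (Lines (L_structure F n D))"
      using annihilator_subset_imp_eq B
      by (auto simp: K.oval_plane_def L_structure_def lines bij_betw_def inj_on_def)
  next
    show "bij_betw point (Circles (K.oval_plane B)) (Circles (L_structure F n D))"
    proof (rule bij_betw_imageI)
      show "inj_on point (Circles (K.oval_plane B))"
      proof (rule inj_onI)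
        fix a b assume "a \<in> Circles (K.oval_plane B)" "b \<in> Circles (K.oval_plane B)" "point a = point b"
        then have ab: "a \<in> carrier (K.vec 3)" "b \<in> carrier (K.vec 3)"
          and "\<Theta> a \<one>\<^bsub>F\<^esub> \<in> point b"
          using F.line_self[of "\<Theta> a \<one>\<^bsub>F\<^esub>" N] by (auto simp: K.oval_plane_def point_def)
        then obtain c where c: "c \<in> carrier F" "\<Theta> a \<one>\<^bsub>F\<^esub> = c \<odot>\<^bsub>F.vec N\<^esub> \<Theta> b \<one>\<^bsub>F\<^esub>"
          by (auto simp: point_def F.line_def)
        then have "\<Theta> a \<one>\<^bsub>F\<^esub> = \<Theta> (\<phi> c \<odot>\<^bsub>K.vec 3\<^esub> b) c"
          using \<Theta>_smult[OF c(1) ab(2), of "\<one>\<^bsub>F\<^esub>"] by simp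
        \<comment> \<open>Comparing the homogenising coordinates of two normalised vectors fixes the
          factor between them.\<close>
        then have "\<one>\<^bsub>F\<^esub> = c" "a = \<phi> c \<odot>\<^bsub>K.vec 3\<^esub> b"
          using ab c by auto
        then show "a = b" using ab by auto
      qed
      show "point ` Circles (K.oval_plane B) = Circles (L_structure F n D)"
      proof (intro equalityI subsetI)
        fix C assume "C \<in> point ` Circles (K.oval_plane B)"
        then obtain a where a: "a \<in> carrier (K.vec 3)" "C = point a"
          by (auto simp: K.oval_plane_def)
        moreover have "\<Theta> a \<one>\<^bsub>F\<^esub> \<in> point a" "\<Theta> a \<one>\<^bsub>F\<^esub> \<notin> hyperplane_at_infinity F n"
          using a F.line_self in_hyperplane by (auto simp: point_def)
        ultimately show "C \<in> Circles (L_structure F n D)"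
          using card_pt[OF a(1)] by (auto simp: L_structure_def pg)
      next
        fix C assume "C \<in> Circles (L_structure F n D)"
        then have C: "subspace F C (F.vec N)" "card C = order F"
          and "\<not> C \<subseteq> hyperplane_at_infinity F n"
          by (auto simp: L_structure_def pg)
        then obtain x where x: "x \<in> C" "x \<notin> hyperplane_at_infinity F n" by blast
        then have "x \<in> carrier (F.vec N)"
          using C(1) by (auto simp: F.subspace_vec_iff)
        then obtain a z where az: "a \<in> carrier (K.vec 3)" "z \<in> carrier F" "x = \<Theta> a z"
          by (rule \<Theta>_cases)
        then have z: "z \<noteq> \<zero>\<^bsub>F\<^esub>" using x(2) in_hyperplane by blast
        then have "x \<noteq> \<zero>\<^bsub>F.vec N\<^esub>" using az by (simp flip: \<Theta>_zero)
        then have "C = F.line N x"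
          using F.subspace_card_order_eq_line C x(1) by blast
        also have "\<dots> = point (\<phi> (inv\<^bsub>F\<^esub> z) \<odot>\<^bsub>K.vec 3\<^esub> a)"
          unfolding point_def using az(1,2) z az(3) by (rule scale)
        finally show "C \<in> point ` Circles (K.oval_plane B)"
          using az F.field_inverse(1)[OF az(2) z] by (auto simp: K.oval_plane_def)
      qed
    qed
  next
    fix p Q assume "p \<in> Points (K.oval_plane B)" "Q \<in> Lines (K.oval_plane B)"
    then obtain P t where p: "p = (P, t)" "P \<in> B" "t \<in> carrier K" "Q \<in> B"
      by (auto simp: K.oval_plane_def)
    have "annihilator Q \<subseteq> affine_plane (P, t) \<longleftrightarrow> P = Q"
    proof
      assume "annihilator Q \<subseteq> affine_plane (P, t)"
      \<comment> \<open>\<open>annihilator Q\<close> lies at infinity, so intersecting with the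
        hyperplane reduces the claim to inclusion of annihilators.\<close>
      then have "annihilator Q \<subseteq> annihilator P"
        using meet[OF p(2,3)] meet[OF p(4) p(3)] by blast
      then show "P = Q"
        using annihilator_subset_imp_eq B p by blast
    qed (use meet[OF p(2,3)] in auto)
    then show "on_line (L_structure F n D) (affine_plane p) (annihilator Q) = on_line (K.oval_plane B) p Q"
      using p by (simp add: L_structure_def K.oval_plane_def)
  next
    fix p a assume "p \<in> Points (K.oval_plane B)" "a \<in> Circles (K.oval_plane B)"
    then obtain P t where p: "p = (P, t)" "P \<in> B" "t \<in> carrier K" "a \<in> carrier (K.vec 3)"
      by (auto simp: K.oval_plane_def)
    then have "point a \<subseteq> affine_plane (P, t) \<longleftrightarrow> K.dot 3 a (K.rep P) = t"
      using point_sub[OF p(4) subspace_affine_plane[of P t]] \<Theta>_one B by auto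
    then show "on_circle (L_structure F n D) (affine_plane p) (point a) = on_circle (K.oval_plane B) p a"
      using p by (simp add: L_structure_def K.oval_plane_def)
  qed
  then show ?thesis
    by (auto simp: isomorphic_def)
qed

end

section \<open>Cones over ovals in PG(3, K)\<close>

text \<open>In this reading the first component is a vector of the base plane rather than a
  functional, and the second is the coordinate in the direction of the vertex.\<close>

locale projective_splitting = semilinear_splitting K K id 4 \<Theta>
  for K :: "'a ring" and \<Theta> :: "(nat \<Rightarrow> 'a) \<Rightarrow> 'a \<Rightarrow> nat \<Rightarrow> 'a"
begin

definition vertex :: "(nat \<Rightarrow> 'a) set"
  where "vertex = im ({\<zero>\<^bsub>K.vec 3\<^esub>} \<times> carrier K)"

definition base :: "(nat \<Rightarrow> 'a) set \<Rightarrow> (nat \<Rightarrow> 'a) set"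
  where "base P = im (P \<times> {\<zero>\<^bsub>K\<^esub>})"

definition generator :: "(nat \<Rightarrow> 'a) set \<Rightarrow> (nat \<Rightarrow> 'a) set"
  where "generator P = im (P \<times> carrier K)"

definition graph_plane :: "(nat \<Rightarrow> 'a) \<Rightarrow> (nat \<Rightarrow> 'a) set"
  where "graph_plane a = im {(x, z). x \<in> carrier (K.vec 3) \<and> z = K.dot 3 a x}"

lemma in_vertex_iff:
  "x \<in> carrier (K.vec 3) \<Longrightarrow> z \<in> carrier K \<Longrightarrow> \<Theta> x z \<in> vertex \<longleftrightarrow> x = \<zero>\<^bsub>K.vec 3\<^esub>"
  unfolding vertex_def by (subst \<Theta>_in_im_iff) auto

lemma in_base_iff:
  "P \<subseteq> carrier (K.vec 3) \<Longrightarrow> x \<in> carrier (K.vec 3) \<Longrightarrow> z \<in> carrier K \<Longrightarrow>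
    \<Theta> x z \<in> base P \<longleftrightarrow> x \<in> P \<and> z = \<zero>\<^bsub>K\<^esub>"
  unfolding base_def
  using \<Theta>_in_im_iff[of "P \<times> {\<zero>\<^bsub>K\<^esub>}" x z] Sigma_mono[of P _ "\<lambda>_. {\<zero>\<^bsub>K\<^esub>}" "\<lambda>_. carrier K"]
  by simp

lemma in_generator_iff:
  "P \<subseteq> carrier (K.vec 3) \<Longrightarrow> x \<in> carrier (K.vec 3) \<Longrightarrow> z \<in> carrier K \<Longrightarrow>
    \<Theta> x z \<in> generator P \<longleftrightarrow> x \<in> P"
  unfolding generator_def
  using \<Theta>_in_im_iff[of "P \<times> carrier K" x z] Sigma_mono[of P _ "\<lambda>_. carrier K" "\<lambda>_. carrier K"]
  by simp

lemma in_graph_plane_iff: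
  "a \<in> carrier (K.vec 3) \<Longrightarrow> x \<in> carrier (K.vec 3) \<Longrightarrow> z \<in> carrier K \<Longrightarrow>
    \<Theta> x z \<in> graph_plane a \<longleftrightarrow> z = K.dot 3 a x"
  unfolding graph_plane_def by (subst \<Theta>_in_im_iff) auto

lemma subspace_closed: "subspace K P (K.vec m) \<Longrightarrow> P \<subseteq> carrier (K.vec m)"
  by (simp add: K.subspace_vec_iff)

lemma subspace_vertex: "subspace K vertex (K.vec 4)"
  unfolding vertex_def by (rule subspace_im) auto

lemma card_vertex: "card vertex = order K"
  unfolding vertex_def by (subst card_im) (auto simp: order_def card_cartesian_product_singleton)

lemma subspace_base: "subspace K P (K.vec 3) \<Longrightarrow> subspace K (base P) (K.vec 4)"
  unfolding base_def by (rule subspace_im) (auto simp: K.subspace_vec_iff)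

lemma card_base: "subspace K P (K.vec 3) \<Longrightarrow> card (base P) = card P"
  unfolding base_def by (subst card_im) (auto simp: K.subspace_vec_iff card_cartesian_product)

lemma subspace_generator: "subspace K P (K.vec 3) \<Longrightarrow> subspace K (generator P) (K.vec 4)"
  unfolding generator_def by (rule subspace_im) (auto simp: K.subspace_vec_iff)

lemma card_generator: "subspace K P (K.vec 3) \<Longrightarrow> card (generator P) = card P * order K"
  unfolding generator_def by (subst card_im) (auto simp: K.subspace_vec_iff order_def card_cartesian_product)

lemma subspace_graph_plane: "a \<in> carrier (K.vec 3) \<Longrightarrow> subspace K (graph_plane a) (K.vec 4)"
  unfolding graph_plane_def by (rule subspace_im) (auto simp: K.dot_add_right K.dot_smult_right)

lemma card_graph_plane: "a \<in> carrier (K.vec 3) \<Longrightarrow> card (graph_plane a) = order K ^ 3"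
proof -
  assume a: "a \<in> carrier (K.vec 3)"
  have "card (graph_plane a) = card {(x, z). x \<in> carrier (K.vec 3) \<and> z = K.dot 3 a x}"
    unfolding graph_plane_def using a by (subst card_im) auto
  also have "\<dots> = card (carrier (K.vec 3))"
    by (rule bij_betw_same_card[of fst]) (auto simp: bij_betw_def inj_on_def image_iff)
  finally show ?thesis by (simp add: K.card_vec)
qed

lemma base_subset_iff:
  assumes "P \<subseteq> carrier (K.vec 3)" "Q \<subseteq> carrier (K.vec 3)"
  shows "base P \<subseteq> base Q \<longleftrightarrow> P \<subseteq> Q"
proof
  assume sub: "base P \<subseteq> base Q"
  show "P \<subseteq> Q"
  proof
    fix x assume "x \<in> P"
    then have "\<Theta> x \<zero>\<^bsub>K\<^esub> \<in> base P" using assms by (subst in_base_iff) auto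
    then show "x \<in> Q" using sub assms \<open>x \<in> P\<close> in_base_iff[of Q x "\<zero>\<^bsub>K\<^esub>"] by auto
  qed
qed (auto simp: base_def im_def)

lemma base_slice:
  assumes W: "subspace K W (K.vec 4)"
  shows "subspace K {x \<in> carrier (K.vec 3). \<Theta> x \<zero>\<^bsub>K\<^esub> \<in> W} (K.vec 3)"
proof -
  have add: "\<Theta> (x \<oplus>\<^bsub>K.vec 3\<^esub> y) \<zero>\<^bsub>K\<^esub> = \<Theta> x \<zero>\<^bsub>K\<^esub> \<oplus>\<^bsub>K.vec 4\<^esub> \<Theta> y \<zero>\<^bsub>K\<^esub>"
    if "x \<in> carrier (K.vec 3)" "y \<in> carrier (K.vec 3)" for x y
    using \<Theta>_add[OF that, of "\<zero>\<^bsub>K\<^esub>" "\<zero>\<^bsub>K\<^esub>"] by simp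
  have smult: "\<Theta> (c \<odot>\<^bsub>K.vec 3\<^esub> x) \<zero>\<^bsub>K\<^esub> = c \<odot>\<^bsub>K.vec 4\<^esub> \<Theta> x \<zero>\<^bsub>K\<^esub>"
    if "x \<in> carrier (K.vec 3)" "c \<in> carrier K" for x c
    using \<Theta>_smult[OF that(2,1), of "\<zero>\<^bsub>K\<^esub>"] that by simp
  show ?thesis
    using W by (auto simp: K.subspace_vec_iff \<Theta>_zero add smult)
qed

lemma oval_base:
  assumes B: "oval K 2 (carrier (K.vec 3)) B"
  shows "oval K 3 (base (carrier (K.vec 3))) (base ` B)"
proof -
  have P: "subspace K P (K.vec 3)" "card P = order K" if "P \<in> B" for P
    using B that by (auto simp: oval_def K.point_iff eval_nat_numeral)
  have "inj_on base B"
    using base_subset_iff P subspace_closed by (intro inj_onI) (metis subset_antisym order_refl)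
  then have card: "card (base ` B) = order K + 1"
    using B by (simp add: card_image oval_def)
  have \<pi>: "base (carrier (K.vec 3)) \<in> pg_subspaces K 3 2"
    using subspace_base[OF K.subspace_carrier] card_base[OF K.subspace_carrier]
    by (simp add: K.pg_subspaces_iff K.card_vec eval_nat_numeral)
  have sub: "base P \<in> pg_subspaces K 3 0 \<and> base P \<subseteq> base (carrier (K.vec 3))" if "P \<in> B" for P
    using P[OF that] subspace_base card_base base_subset_iff[of P "carrier (K.vec 3)"] subspace_closed
    by (simp add: K.pg_subspaces_iff)
  have "\<not> (\<exists>l\<in>pg_subspaces K 3 1. base P \<subseteq> l \<and> base Q \<subseteq> l \<and> base R \<subseteq> l)"
    if PQR: "P \<in> B" "Q \<in> B" "R \<in> B" "P \<noteq> Q" "P \<noteq> R" "Q \<noteq> R" for P Q R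
  proof
    assume "\<exists>l\<in>pg_subspaces K 3 1. base P \<subseteq> l \<and> base Q \<subseteq> l \<and> base R \<subseteq> l"
    then obtain l where l: "subspace K l (K.vec 4)" "card l = order K ^ 2"
      "base P \<subseteq> l" "base Q \<subseteq> l" "base R \<subseteq> l"
      by (auto simp: K.pg_subspaces_iff eval_nat_numeral)
    let ?W = "{x \<in> carrier (K.vec 3). \<Theta> x \<zero>\<^bsub>K\<^esub> \<in> l}"
    have in_W: "X \<subseteq> ?W" if "X \<in> B" "base X \<subseteq> l" for X
      using subspace_closed[OF P(1)[OF that(1)]] that(2) in_base_iff[of X _ "\<zero>\<^bsub>K\<^esub>"] by blast
    have "?W = carrier (K.vec 3)"
      by (rule K.oval_span_eq[OF B PQR base_slice[OF l(1)]]) (use in_W PQR l in auto)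
    then have "base (carrier (K.vec 3)) \<subseteq> l"
      by (auto simp: base_def im_def)
    then have "order K ^ 3 \<le> order K ^ 2"
      using card_mono[OF K.subspace_finite[OF l(1)]] l(2) card_base[OF K.subspace_carrier[of 3]]
        K.card_vec[of 3] by metis
    then show False using K.order_gt_1 by simp
  qed
  then have three: "\<forall>X\<in>base ` B. \<forall>Y\<in>base ` B. \<forall>Z\<in>base ` B. X \<noteq> Y \<longrightarrow> X \<noteq> Z \<longrightarrow> Y \<noteq> Z \<longrightarrow>
      \<not> (\<exists>l\<in>pg_subspaces K 3 1. X \<subseteq> l \<and> Y \<subseteq> l \<and> Z \<subseteq> l)"
    by (intro ballI impI) (elim imageE, metis)
  have "base ` B \<subseteq> {P \<in> pg_subspaces K 3 0. P \<subseteq> base (carrier (K.vec 3))}"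
    using sub by blast
  then show ?thesis
    unfolding oval_def by (intro conjI \<pi> card three)
qed

text \<open>Slicing undoes \<open>base\<close> on subspaces of the base plane, and
  \<open>base\<close> takes lines of the plane to lines of the space. Three collinear slices would
  thus give three collinear points in space.\<close>

lemma oval_from_base:
  assumes B': "oval K 3 (base (carrier (K.vec 3))) B'"
  obtains B where "oval K 2 (carrier (K.vec 3)) B" "B' = base ` B"
proof -
  define slice where "slice X = {x \<in> carrier (K.vec 3). \<Theta> x \<zero>\<^bsub>K\<^esub> \<in> X}" for X
  have X: "subspace K X (K.vec 4)" "card X = order K" "X \<subseteq> base (carrier (K.vec 3))" if "X \<in> B'" for X
    using B' that by (auto simp: oval_def K.point_iff eval_nat_numeral)
  have base_slice_eq: "base (slice X) = X" if "X \<in> B'" for X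
    using X(3)[OF that] by (auto simp: slice_def base_def im_def)
  have slice: "subspace K (slice X) (K.vec 3)" "card (slice X) = order K" if "X \<in> B'" for X
    using base_slice X[OF that] card_base[of "slice X"] base_slice_eq[OF that] by (auto simp: slice_def)
  have "inj_on slice B'"
    by (rule inj_on_inverseI) (rule base_slice_eq)
  then have card: "card (slice ` B') = order K + 1"
    using B' by (simp add: card_image oval_def)
  have "\<not> (\<exists>l\<in>pg_subspaces K 2 1. slice X \<subseteq> l \<and> slice Y \<subseteq> l \<and> slice Z \<subseteq> l)"
    if XYZ: "X \<in> B'" "Y \<in> B'" "Z \<in> B'" "X \<noteq> Y" "X \<noteq> Z" "Y \<noteq> Z" for X Y Z
  proof
    assume "\<exists>l\<in>pg_subspaces K 2 1. slice X \<subseteq> l \<and> slice Y \<subseteq> l \<and> slice Z \<subseteq> l"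
    then obtain l where l: "subspace K l (K.vec 3)" "card l = order K ^ 2"
      "slice X \<subseteq> l" "slice Y \<subseteq> l" "slice Z \<subseteq> l"
      by (auto simp: K.pg_subspaces_iff eval_nat_numeral)
    have "base l \<in> pg_subspaces K 3 1"
      using subspace_base[OF l(1)] card_base[OF l(1)] l(2)
      by (simp add: K.pg_subspaces_iff eval_nat_numeral)
    moreover have sub: "W \<subseteq> base l" if "W \<in> B'" "slice W \<subseteq> l" for W
      using base_subset_iff[of "slice W" l] that slice[OF that(1)] l(1) subspace_closed base_slice_eq[OF that(1)]
      by simp
    moreover have "\<not> (\<exists>l\<in>pg_subspaces K 3 1. X \<subseteq> l \<and> Y \<subseteq> l \<and> Z \<subseteq> l)"
      by (rule B'[unfolded oval_def, THEN conjunct2, THEN conjunct2, THEN conjunct2, rule_format, OF XYZ])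
    ultimately show False using sub[OF XYZ(1) l(3)] sub[OF XYZ(2) l(4)] sub[OF XYZ(3) l(5)] by metis
  qed
  then have "\<forall>P\<in>slice ` B'. \<forall>Q\<in>slice ` B'. \<forall>R\<in>slice ` B'. P \<noteq> Q \<longrightarrow> P \<noteq> R \<longrightarrow> Q \<noteq> R \<longrightarrow>
      \<not> (\<exists>l\<in>pg_subspaces K 2 1. P \<subseteq> l \<and> Q \<subseteq> l \<and> R \<subseteq> l)"
    by (intro ballI impI) (elim imageE, metis)
  moreover have "carrier (K.vec 3) \<in> pg_subspaces K 2 2"
    using K.subspace_carrier[of 3] by (simp add: K.pg_subspaces_iff K.card_vec eval_nat_numeral)
  moreover have "slice ` B' \<subseteq> {P \<in> pg_subspaces K 2 0. P \<subseteq> carrier (K.vec 3)}"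
    using slice by (auto simp: K.pg_subspaces_iff slice_def)
  ultimately have "oval K 2 (carrier (K.vec 3)) (slice ` B')"
    unfolding oval_def using card by (intro conjI)
  moreover have "B' = base ` slice ` B'"
    using base_slice_eq by (auto simp: image_image)
  ultimately show thesis by (rule that)
qed

text \<open>A line through the vertex and \<open>base P\<close> contains every sum of a vector of
  each. These sums already make up q^2 vectors, as many as the line has.\<close>

lemma generators_eq:
  assumes B: "B \<subseteq> pg_subspaces K 2 0"
  shows "generators K vertex (base ` B) = generator ` B"
proof -
  have P: "subspace K P (K.vec 3)" "card P = order K" if "P \<in> B" for P
    using B that by (auto simp: K.point_iff eval_nat_numeral)
  show ?thesis
  proof (intro equalityI subsetI)
    fix g assume "g \<in> generators K vertex (base ` B)"
    then obtain P where g: "subspace K g (K.vec 4)" "card g = order K ^ 2" "vertex \<subseteq> g" "P \<in> B" "base P \<subseteq> g"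
      by (auto simp: generators_def K.pg_subspaces_iff eval_nat_numeral)
    have "generator P \<subseteq> g"
    proof
      fix y assume "y \<in> generator P"
      then obtain x z where xz: "x \<in> P" "z \<in> carrier K" "y = \<Theta> x z"
        by (auto simp: generator_def im_def)
      then have x: "x \<in> carrier (K.vec 3)" using P(1)[OF g(4)] subspace_closed by blast
      have "\<Theta> x \<zero>\<^bsub>K\<^esub> \<in> g" "\<Theta> \<zero>\<^bsub>K.vec 3\<^esub> z \<in> g"
        using g(3,5) xz by (auto simp: base_def vertex_def im_def)
      then have "\<Theta> x \<zero>\<^bsub>K\<^esub> \<oplus>\<^bsub>K.vec 4\<^esub> \<Theta> \<zero>\<^bsub>K.vec 3\<^esub> z \<in> g"
        using g(1) by (simp add: K.subspace_vec_iff)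
      moreover have "\<Theta> x \<zero>\<^bsub>K\<^esub> \<oplus>\<^bsub>K.vec 4\<^esub> \<Theta> \<zero>\<^bsub>K.vec 3\<^esub> z = y"
        using \<Theta>_add[of x "\<zero>\<^bsub>K.vec 3\<^esub>" "\<zero>\<^bsub>K\<^esub>" z] x xz by simp
      ultimately show "y \<in> g" by simp
    qed
    then have "generator P = g"
      using subset_subspace_eq[OF g(1)] card_generator P[OF g(4)] g(2) by (simp add: power2_eq_square)
    then show "g \<in> generator ` B" using g(4) by blast
  next
    fix g assume "g \<in> generator ` B"
    then obtain P where gP: "P \<in> B" "g = generator P" by blast
    note P = P[OF gP(1)]
    have "\<zero>\<^bsub>K.vec 3\<^esub> \<in> P" using P by (simp add: K.subspace_vec_iff)
    then have "vertex \<subseteq> g" by (auto simp: gP vertex_def generator_def im_def)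
    moreover have "base P \<subseteq> g" by (auto simp: gP base_def generator_def im_def)
    moreover have "g \<in> pg_subspaces K 3 1"
      using subspace_generator[OF P(1)] card_generator[OF P(1)] P(2) gP(2)
      by (simp add: K.pg_subspaces_iff eval_nat_numeral)
    ultimately show "g \<in> generators K vertex (base ` B)"
      using gP(1) by (auto simp: generators_def)
  qed
qed

text \<open>A plane missing the vertex meets each line through it in one point, so it is the graph of a
  linear functional.\<close>

lemma plane_eq_graph_plane:
  assumes \<rho>: "subspace K \<rho> (K.vec 4)" "card \<rho> = order K ^ 3" and vertex: "\<not> vertex \<subseteq> \<rho>"
  obtains a where "a \<in> carrier (K.vec 3)" "\<rho> = graph_plane a"
proof -
  define U where "U = {(x, z). x \<in> carrier (K.vec 3) \<and> z \<in> carrier K \<and> \<Theta> x z \<in> \<rho>}"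
  have add: "(x \<oplus>\<^bsub>K.vec 3\<^esub> y, z \<oplus>\<^bsub>K\<^esub> w) \<in> U" if "(x, z) \<in> U" "(y, w) \<in> U" for x y z w
    using that \<rho>(1) \<Theta>_add[of x y z w] by (auto simp: U_def K.subspace_vec_iff)
  have smult: "(c \<odot>\<^bsub>K.vec 3\<^esub> x, c \<otimes>\<^bsub>K\<^esub> z) \<in> U" if "(x, z) \<in> U" "c \<in> carrier K" for x z c
    using that \<rho>(1) \<Theta>_smult[of c x z] by (auto simp: U_def K.subspace_vec_iff)
  \<comment> \<open>One nonzero vector in the direction of the vertex would bring all its multiples,
    hence the whole vertex, into the plane.\<close>
  have zero: "z = \<zero>\<^bsub>K\<^esub>" if z: "(\<zero>\<^bsub>K.vec 3\<^esub>, z) \<in> U" for z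
  proof (rule ccontr)
    assume nz: "z \<noteq> \<zero>\<^bsub>K\<^esub>"
    have zK: "z \<in> carrier K" using z by (simp add: U_def)
    have "(\<zero>\<^bsub>K.vec 3\<^esub>, w) \<in> U" if "w \<in> carrier K" for w
      using smult[OF z, of "w \<otimes>\<^bsub>K\<^esub> inv\<^bsub>K\<^esub> z"] K.field_inverse[OF zK nz] that zK by (simp add: K.m_assoc)
    then have "vertex \<subseteq> \<rho>" by (auto simp: vertex_def im_def U_def)
    then show False using vertex by simp
  qed
  have uniq: "z = w" if zw: "(x, z) \<in> U" "(x, w) \<in> U" for x z w
  proof -
    have x: "x \<in> carrier (K.vec 3)" "z \<in> carrier K" "w \<in> carrier K" using zw by (auto simp: U_def)
    have "(x \<oplus>\<^bsub>K.vec 3\<^esub> (\<ominus>\<^bsub>K\<^esub> \<one>\<^bsub>K\<^esub>) \<odot>\<^bsub>K.vec 3\<^esub> x, z \<oplus>\<^bsub>K\<^esub> (\<ominus>\<^bsub>K\<^esub> \<one>\<^bsub>K\<^esub>) \<otimes>\<^bsub>K\<^esub> w) \<in> U"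
      by (intro add smult zw) simp
    moreover have "x \<oplus>\<^bsub>K.vec 3\<^esub> (\<ominus>\<^bsub>K\<^esub> \<one>\<^bsub>K\<^esub>) \<odot>\<^bsub>K.vec 3\<^esub> x = \<zero>\<^bsub>K.vec 3\<^esub>"
      by (rule K.vec_eqI[of _ 3]) (use x in \<open>auto simp: K.l_minus K.r_neg\<close>)
    ultimately have "z \<ominus>\<^bsub>K\<^esub> w = \<zero>\<^bsub>K\<^esub>"
      using zero x by (simp add: K.l_minus a_minus_def)
    then show ?thesis using x by simp
  qed
  have U_dom: "U \<subseteq> carrier (K.vec 3) \<times> carrier K" by (auto simp: U_def)
  have \<rho>_eq: "\<rho> = im U"
  proof (intro equalityI subsetI)
    fix y assume y: "y \<in> \<rho>"
    then have "y \<in> carrier (K.vec 4)" using \<rho>(1) subspace_closed by blast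
    then obtain x z where "x \<in> carrier (K.vec 3)" "z \<in> carrier K" "y = \<Theta> x z"
      by (rule \<Theta>_cases)
    then show "y \<in> im U" using y by (auto simp: im_def U_def)
  qed (auto simp: im_def U_def)
  \<comment> \<open>The plane has as many vectors as K^3, so the injective projection is onto, and
    \<open>U\<close> is the graph of a function defined everywhere.\<close>
  have "inj_on fst U" using uniq by (auto intro!: inj_onI)
  then have "card (fst ` U) = card (carrier (K.vec 3))"
    using \<rho>(2) card_im[OF U_dom] by (simp add: card_image \<rho>_eq K.card_vec)
  then have fst_U: "fst ` U = carrier (K.vec 3)"
    using U_dom by (intro card_subset_eq K.finite_vec) auto
  define \<gamma> where "\<gamma> x = (THE z. (x, z) \<in> U)" for x
  have \<gamma>_eq: "\<gamma> x = z" if "(x, z) \<in> U" for x z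
    unfolding \<gamma>_def using that
  proof (rule the_equality)
    show "w = z" if "(x, w) \<in> U" for w using that \<open>(x, z) \<in> U\<close> by (rule uniq)
  qed
  have \<gamma>: "(x, \<gamma> x) \<in> U" if "x \<in> carrier (K.vec 3)" for x
  proof -
    obtain z where "(x, z) \<in> U" using fst_U \<open>x \<in> _\<close> by force
    then show ?thesis using \<gamma>_eq by simp
  qed
  have \<gamma>_closed: "\<gamma> x \<in> carrier K" if "x \<in> carrier (K.vec 3)" for x
    using \<gamma>[OF that] by (simp add: U_def)
  define a where "a = (\<lambda>i\<in>{..<3}. \<gamma> (K.unit_vector 3 i))"
  have a: "a \<in> carrier (K.vec 3)"
    using \<gamma>_closed by (auto simp: a_def K.carrier_vec K.unit_vector_closed[unfolded K.carrier_vec])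
  have \<gamma>_dot: "\<gamma> x = K.dot 3 a x" if "x \<in> carrier (K.vec 3)" for x
    unfolding a_def
  proof (rule K.linear_functional_eq_dot[OF _ _ _ that])
    show "\<gamma> \<in> carrier (K.vec 3) \<rightarrow> carrier K" using \<gamma>_closed by blast
  next
    fix x y assume "x \<in> carrier (K.vec 3)" "y \<in> carrier (K.vec 3)"
    then show "\<gamma> (x \<oplus>\<^bsub>K.vec 3\<^esub> y) = \<gamma> x \<oplus>\<^bsub>K\<^esub> \<gamma> y"
      by (intro \<gamma>_eq add \<gamma>)
  next
    fix c x assume "c \<in> carrier K" "x \<in> carrier (K.vec 3)"
    then show "\<gamma> (c \<odot>\<^bsub>K.vec 3\<^esub> x) = c \<otimes>\<^bsub>K\<^esub> \<gamma> x"
      by (intro \<gamma>_eq smult \<gamma>)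
  qed
  have "graph_plane a \<subseteq> \<rho>"
  proof
    fix y assume "y \<in> graph_plane a"
    then obtain x where x: "x \<in> carrier (K.vec 3)" "y = \<Theta> x (K.dot 3 a x)"
      by (auto simp: graph_plane_def im_def)
    then show "y \<in> \<rho>" using \<gamma>[OF x(1)] \<gamma>_dot[OF x(1)] by (simp add: U_def)
  qed
  then have "graph_plane a = \<rho>"
    using subset_subspace_eq[OF \<rho>(1)] card_graph_plane[OF a] \<rho>(2) by simp
  then show thesis using that a by blast
qed

text \<open>The pair \<open>(P, t)\<close> becomes the projective point spanned by
  \<open>\<Theta> (rep P) t\<close>. The equation of \<open>graph_plane a\<close> at this vector is
  literally the incidence condition of the model.\<close>

theorem oval_plane_isomorphic_cone_structure:
  assumes B: "oval K 2 (carrier (K.vec 3)) B"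
  shows "isomorphic (K.oval_plane B) (cone_structure K vertex (base ` B))"
proof -
  define point where "point p = K.line 4 (\<Theta> (K.rep (fst p)) (snd p))" for p :: "(nat \<Rightarrow> 'a) set \<times> 'a"
  define conic where "conic a = {X \<in> cone K vertex (base ` B). X \<subseteq> graph_plane a}" for a
  have BP: "P \<in> pg_subspaces K 2 0" if "P \<in> B" for P
    using B that by (auto simp: oval_def)
  have P: "subspace K P (K.vec 3)" "card P = order K" if "P \<in> B" for P
    using BP[OF that] by (auto simp: K.point_iff eval_nat_numeral)
  have gens: "generators K vertex (base ` B) = generator ` B"
    by (rule generators_eq) (use BP in blast)
  have cone_iff: "X \<in> cone K vertex (base ` B) \<longleftrightarrow>
      subspace K X (K.vec 4) \<and> card X = order K \<and> (\<exists>P\<in>B. X \<subseteq> generator P)" for X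
    by (simp add: cone_def gens K.pg_subspaces_iff)
  have rep_closed: "\<Theta> (K.rep P) t \<in> carrier (K.vec 4)" if "P \<in> B" "t \<in> carrier K" for P t
    using K.rep(3)[OF BP] that by simp
  have rep_nonzero: "\<Theta> (K.rep P) t \<noteq> \<zero>\<^bsub>K.vec 4\<^esub>" if "P \<in> B" "t \<in> carrier K" for P t
    using K.rep[OF BP[OF that(1)]] that by (simp flip: \<Theta>_zero)
  have point_subset_iff: "point (P, t) \<subseteq> W \<longleftrightarrow> \<Theta> (K.rep P) t \<in> W"
    if "P \<in> B" "t \<in> carrier K" "subspace K W (K.vec 4)" for P t W
    unfolding point_def using K.line_subset_iff[OF that(3) rep_closed[OF that(1,2)]] by simp
  have point_subspace: "subspace K (point (P, t)) (K.vec 4)" "card (point (P, t)) = order K"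
    if "P \<in> B" "t \<in> carrier K" for P t
    using K.subspace_line K.card_line rep_closed[OF that] rep_nonzero[OF that] by (auto simp: point_def)
  have on_generator: "point (P, t) \<subseteq> generator Q \<longleftrightarrow> P = Q"
    if "P \<in> B" "t \<in> carrier K" "Q \<in> B" for P t Q
  proof -
    have "point (P, t) \<subseteq> generator Q \<longleftrightarrow> K.rep P \<in> Q"
      using point_subset_iff[OF that(1,2) subspace_generator[OF P(1)[OF that(3)]]]
        in_generator_iff[OF subspace_closed[OF P(1)[OF that(3)]] K.rep(3)[OF BP[OF that(1)]] that(2)]
      by simp
    then show ?thesis
      using K.point_eqI[OF BP[OF that(1)] BP[OF that(3)]] K.rep(1)[OF BP[OF that(1)]] by auto
  qed
  have point_cone: "point (P, t) \<in> cone K vertex (base ` B)" if "P \<in> B" "t \<in> carrier K" for P t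
    unfolding cone_iff using point_subspace[OF that] on_generator[OF that that(1)] that(1) by blast
  have on_graph: "point (P, t) \<subseteq> graph_plane a \<longleftrightarrow> K.dot 3 a (K.rep P) = t"
    if "P \<in> B" "t \<in> carrier K" "a \<in> carrier (K.vec 3)" for P t a
    using point_subset_iff[OF that(1,2) subspace_graph_plane[OF that(3)]]
      in_graph_plane_iff[OF that(3) K.rep(3)[OF BP[OF that(1)]] that(2)] by auto
  have vertex_graph: "\<not> vertex \<subseteq> graph_plane a" if a: "a \<in> carrier (K.vec 3)" for a
  proof
    assume "vertex \<subseteq> graph_plane a"
    moreover have "\<Theta> \<zero>\<^bsub>K.vec 3\<^esub> \<one>\<^bsub>K\<^esub> \<in> vertex" by (simp add: in_vertex_iff)
    ultimately show False
      using in_graph_plane_iff[OF a, of "\<zero>\<^bsub>K.vec 3\<^esub>" "\<one>\<^bsub>K\<^esub>"] a by auto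
  qed
  have "isomorphism (K.oval_plane B) (cone_structure K vertex (base ` B)) point generator conic"
    unfolding isomorphism_def
  proof (intro conjI ballI)
    show "bij_betw point (Points (K.oval_plane B)) (Points (cone_structure K vertex (base ` B)))"
    proof (rule bij_betw_imageI)
      show "inj_on point (Points (K.oval_plane B))"
      proof (rule inj_onI)
        fix p q assume "p \<in> Points (K.oval_plane B)" "q \<in> Points (K.oval_plane B)"
          and eq: "point p = point q"
        then obtain P t Q s where pq: "p = (P, t)" "q = (Q, s)" "P \<in> B" "Q \<in> B"
          "t \<in> carrier K" "s \<in> carrier K"
          by (auto simp: K.oval_plane_def)
        have PQ: "P = Q"
          using on_generator[of Q s P] on_generator[of P t P] eq pq by simp
        obtain a where a: "a \<in> carrier (K.vec 3)" "K.dot 3 a (K.rep P) = t"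
          using K.dot_surj[of "K.rep P" 3 t] K.rep[OF BP[OF pq(3)]] pq by blast
        then have "t = s"
          using on_graph[of P t a] on_graph[of P s a] eq pq PQ by simp
        then show "p = q" using pq PQ by simp
      qed
      show "point ` Points (K.oval_plane B) = Points (cone_structure K vertex (base ` B))"
      proof (intro equalityI subsetI)
        fix X assume "X \<in> point ` Points (K.oval_plane B)"
        then obtain Q t where X: "X = point (Q, t)" "Q \<in> B" "t \<in> carrier K"
          by (auto simp: K.oval_plane_def)
        have "\<Theta> (K.rep Q) t \<notin> vertex"
          using in_vertex_iff X K.rep[OF BP[OF X(2)]] by simp
        then have "X \<noteq> vertex"
          using point_subset_iff[OF X(2,3) subspace_vertex] X(1) by auto
        then show "X \<in> Points (cone_structure K vertex (base ` B))"
          using point_cone X by (simp add: cone_structure_def)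
      next
        fix X assume "X \<in> Points (cone_structure K vertex (base ` B))"
        then have "X \<in> cone K vertex (base ` B)" "X \<noteq> vertex"
          by (auto simp: cone_structure_def)
        then obtain Q where X: "subspace K X (K.vec 4)" "card X = order K" "Q \<in> B" "X \<subseteq> generator Q"
          unfolding cone_iff by blast
        \<comment> \<open>Both are projective points, so inclusion would already mean equality. A
          vector outside the vertex is needed because its component in K^3 is nonzero.\<close>
        have "\<not> X \<subseteq> vertex"
          using subset_subspace_eq[OF subspace_vertex] card_vertex X(2) \<open>X \<noteq> vertex\<close> by metis
        then obtain y where y: "y \<in> X" "y \<notin> vertex" by blast
        then obtain x z where xz: "x \<in> Q" "z \<in> carrier K" "y = \<Theta> x z"
          using X(4) by (auto simp: generator_def im_def)
        then have x: "x \<in> carrier (K.vec 3)"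
          using subspace_closed[OF P(1)[OF X(3)]] by blast
        have "x \<noteq> \<zero>\<^bsub>K.vec 3\<^esub>" using y(2) xz in_vertex_iff[OF x] by simp
        \<comment> \<open>The component in K^3 is a nonzero multiple of \<open>rep Q\<close>;
          dividing by that factor normalises it and leaves \<open>z / c\<close> as the parameter of
          \<open>X\<close>.\<close>
        moreover obtain c where c: "c \<in> carrier K" "x = c \<odot>\<^bsub>K.vec 3\<^esub> K.rep Q"
          using xz(1) K.rep(4)[OF BP[OF X(3)]] by (auto simp: K.line_def)
        ultimately have "c \<noteq> \<zero>\<^bsub>K\<^esub>"
          using K.rep(3)[OF BP[OF X(3)]] by auto
        note inv = K.field_inverse[OF c(1) this]
        have "inv\<^bsub>K\<^esub> c \<odot>\<^bsub>K.vec 3\<^esub> x = K.rep Q"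
          using c inv K.rep(3)[OF BP[OF X(3)]] by (simp add: K.vec_smult_assoc)
        then have "inv\<^bsub>K\<^esub> c \<odot>\<^bsub>K.vec 4\<^esub> y = \<Theta> (K.rep Q) (inv\<^bsub>K\<^esub> c \<otimes>\<^bsub>K\<^esub> z)"
          using \<Theta>_smult[OF inv(1) x xz(2)] xz(3) by simp
        moreover have "inv\<^bsub>K\<^esub> c \<odot>\<^bsub>K.vec 4\<^esub> y \<in> X"
          using X(1) inv(1) y(1) by (simp add: K.subspace_vec_iff)
        ultimately have "X = point (Q, inv\<^bsub>K\<^esub> c \<otimes>\<^bsub>K\<^esub> z)"
          unfolding point_def
          using K.subspace_card_order_eq_line[OF X(1,2)] rep_nonzero[OF X(3)] inv(1) xz(2) by simp
        then show "X \<in> point ` Points (K.oval_plane B)"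
          using X(3) inv(1) xz(2) by (auto simp: K.oval_plane_def)
      qed
    qed
  next
    have "inj_on generator B"
    proof (rule inj_onI)
      fix Q R assume QR: "Q \<in> B" "R \<in> B" "generator Q = generator R"
      then show "Q = R"
        using on_generator[of Q "\<zero>\<^bsub>K\<^esub>" Q] on_generator[of Q "\<zero>\<^bsub>K\<^esub>" R] by simp
    qed
    then show "bij_betw generator (Lines (K.oval_plane B)) (Lines (cone_structure K vertex (base ` B)))"
      by (simp add: bij_betw_def K.oval_plane_def cone_structure_def gens)
  next
    show "bij_betw conic (Circles (K.oval_plane B)) (Circles (cone_structure K vertex (base ` B)))"
    proof (rule bij_betw_imageI)
      show "inj_on conic (Circles (K.oval_plane B))"
      proof (rule inj_onI)
        fix a b assume "a \<in> Circles (K.oval_plane B)" "b \<in> Circles (K.oval_plane B)"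
          and eq: "conic a = conic b"
        then have ab: "a \<in> carrier (K.vec 3)" "b \<in> carrier (K.vec 3)"
          by (auto simp: K.oval_plane_def)
        \<comment> \<open>Circles of the cone are sets of points, so the plane has to be recovered
          from its section. Each generator carries one point of the section, and that point
          determines the value of the functional there; the oval then spans K^3.\<close>
        have "K.dot 3 a x = K.dot 3 b x" if "Q \<in> B" "x \<in> Q" for Q x
        proof -
          note rep = K.rep[OF BP[OF that(1)]]
          define t where "t = K.dot 3 a (K.rep Q)"
          have t: "t \<in> carrier K" using ab rep by (simp add: t_def)
          have "point (Q, t) \<in> conic a"
            using point_cone[OF that(1) t] on_graph[OF that(1) t ab(1)] by (simp add: conic_def t_def)
          then have "point (Q, t) \<in> conic b"
            using eq by simp
          then have "K.dot 3 b (K.rep Q) = t"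
            using on_graph[OF that(1) t ab(2)] by (simp add: conic_def)
          moreover obtain c where "c \<in> carrier K" "x = c \<odot>\<^bsub>K.vec 3\<^esub> K.rep Q"
            using \<open>x \<in> Q\<close> rep(4) by (auto simp: K.line_def)
          ultimately show ?thesis
            using ab rep(3) by (simp add: K.dot_smult_right t_def)
        qed
        then show "a = b" by (rule K.oval_dot_cancel[OF B ab])
      qed
      show "conic ` Circles (K.oval_plane B) = Circles (cone_structure K vertex (base ` B))"
      proof (intro equalityI subsetI)
        fix C assume "C \<in> conic ` Circles (K.oval_plane B)"
        then obtain a where a: "a \<in> carrier (K.vec 3)" "C = conic a"
          by (auto simp: K.oval_plane_def)
        moreover have "graph_plane a \<in> pg_subspaces K 3 2"
          using subspace_graph_plane[OF a(1)] card_graph_plane[OF a(1)]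
          by (simp add: K.pg_subspaces_iff eval_nat_numeral)
        ultimately show "C \<in> Circles (cone_structure K vertex (base ` B))"
          using vertex_graph[OF a(1)] by (auto simp: cone_structure_def conic_def)
      next
        fix C assume "C \<in> Circles (cone_structure K vertex (base ` B))"
        then obtain \<rho> where \<rho>: "\<rho> \<in> pg_subspaces K 3 2" "\<not> vertex \<subseteq> \<rho>"
          "C = {X \<in> cone K vertex (base ` B). X \<subseteq> \<rho>}"
          by (auto simp: cone_structure_def)
        then have "subspace K \<rho> (K.vec 4)" "card \<rho> = order K ^ 3"
          by (auto simp: K.pg_subspaces_iff eval_nat_numeral)
        then obtain a where "a \<in> carrier (K.vec 3)" "\<rho> = graph_plane a"
          using plane_eq_graph_plane \<rho>(2) by blast
        then show "C \<in> conic ` Circles (K.oval_plane B)"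
          using \<rho>(3) by (auto simp: K.oval_plane_def conic_def)
      qed
    qed
  next
    fix p Q assume "p \<in> Points (K.oval_plane B)" "Q \<in> Lines (K.oval_plane B)"
    then obtain P t where "p = (P, t)" "P \<in> B" "t \<in> carrier K" "Q \<in> B"
      by (auto simp: K.oval_plane_def)
    then show "on_line (cone_structure K vertex (base ` B)) (point p) (generator Q) = on_line (K.oval_plane B) p Q"
      using on_generator by (simp add: K.oval_plane_def cone_structure_def)
  next
    fix p a assume "p \<in> Points (K.oval_plane B)" "a \<in> Circles (K.oval_plane B)"
    then obtain Q t where "p = (Q, t)" "Q \<in> B" "t \<in> carrier K" "a \<in> carrier (K.vec 3)"
      by (auto simp: K.oval_plane_def)
    then show "on_circle (cone_structure K vertex (base ` B)) (point p) (conic a) = on_circle (K.oval_plane B) p a"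
      using on_graph point_cone by (simp add: K.oval_plane_def cone_structure_def conic_def)
  qed
  then show ?thesis
    by (auto simp: isomorphic_def)
qed

end

section \<open>Coordinates adapted to a vertex and a base plane\<close>

context finite_field
begin

lemma vec_extend_add:
  "(x \<oplus>\<^bsub>vec m\<^esub> y)(m := z \<oplus> w) = x(m := z) \<oplus>\<^bsub>vec (Suc m)\<^esub> y(m := w)"
  by (auto simp: func_space_def fun_eq_iff less_Suc_eq)

lemma vec_extend_smult:
  "(c \<odot>\<^bsub>vec m\<^esub> x)(m := c \<otimes> z) = c \<odot>\<^bsub>vec (Suc m)\<^esub> x(m := z)"
  by (auto simp: func_space_def fun_eq_iff less_Suc_eq)

lemma vec_extend_bij:
  "bij_betw (\<lambda>(x, z). x(m := z)) (carrier (vec m) \<times> carrier F) (carrier (vec (Suc m)))"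
proof (rule bij_betw_byWitness[where f' = "\<lambda>y. (restrict y {..<m}, y m)"])
  show "\<forall>p\<in>carrier (vec m) \<times> carrier F. (restrict ((\<lambda>(x, z). x(m := z)) p) {..<m}, (\<lambda>(x, z). x(m := z)) p m) = p"
    by (auto simp: carrier_vec fun_eq_iff PiE_def extensional_def)
  show "\<forall>y\<in>carrier (vec (Suc m)). (\<lambda>(x, z). x(m := z)) (restrict y {..<m}, y m) = y"
    by (auto simp: carrier_vec fun_eq_iff PiE_def extensional_def)
  show "(\<lambda>(x, z). x(m := z)) ` (carrier (vec m) \<times> carrier F) \<subseteq> carrier (vec (Suc m))"
    by (auto simp: carrier_vec PiE_def extensional_def less_Suc_eq)
  show "(\<lambda>y. (restrict y {..<m}, y m)) ` carrier (vec (Suc m)) \<subseteq> carrier (vec m) \<times> carrier F"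
  proof (rule image_subsetI)
    fix y assume "y \<in> carrier (vec (Suc m))"
    then have y: "y i \<in> carrier F" if "i < Suc m" for i
      using that by (rule vec_coord)
    then have "restrict y {..<m} \<in> carrier (vec m)"
      unfolding carrier_vec by (intro PiE_I) simp_all
    then show "(restrict y {..<m}, y m) \<in> carrier (vec m) \<times> carrier F"
      using y[of m] by simp
  qed
qed

lemma standard_projective_splitting: "projective_splitting F (\<lambda>x z. x(3 := z))"
proof unfold_locales
  show "id \<in> ring_hom F F" by simp
  show "bij_betw (\<lambda>(x, z). x(3 := z)) (carrier (vec 3) \<times> carrier F) (carrier (vec 4))"
    using vec_extend_bij[of 3] by simp
  show "(x \<oplus>\<^bsub>vec 3\<^esub> y)(3 := z \<oplus> w) = x(3 := z) \<oplus>\<^bsub>vec 4\<^esub> y(3 := w)" for x y z w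
    using vec_extend_add[of 3 x y z w] by simp
  show "(id c \<odot>\<^bsub>vec 3\<^esub> x)(3 := c \<otimes> z) = c \<odot>\<^bsub>vec 4\<^esub> x(3 := z)" for c x z
    using vec_extend_smult[of 3 c x z] by simp
qed

text \<open>Coordinates \<open>\<psi>\<close> of the plane together with a generator
  \<open>v\<close> of the vertex split the whole space as a direct sum. Hence any vertex and any
  plane that misses it can be put into the standard position.\<close>

lemma projective_splitting_exists:
  assumes V: "V \<in> pg_subspaces F 3 0" and \<pi>: "\<pi> \<in> pg_subspaces F 3 2" and nsub: "\<not> V \<subseteq> \<pi>"
  obtains \<Theta> where "projective_splitting F \<Theta>"
    "V = projective_splitting.vertex F \<Theta>"
    "\<pi> = projective_splitting.base F \<Theta> (carrier (vec 3))"
proof -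
  have \<pi>_sub: "subspace F \<pi> (vec 4)" and dim: "vectorspace.dim F ((vec 4)\<lparr>carrier := \<pi>\<rparr>) = 3"
    using \<pi> by (auto simp: pg_subspaces_def)
  have V_sub: "subspace F V (vec 4)" "card V = order F"
    using V by (auto simp: pg_subspaces_iff)
  have \<pi>_closed: "\<pi> \<subseteq> carrier (vec 4)"
    and \<pi>_add: "\<And>x y. x \<in> \<pi> \<Longrightarrow> y \<in> \<pi> \<Longrightarrow> x \<oplus>\<^bsub>vec 4\<^esub> y \<in> \<pi>"
    and \<pi>_smult: "\<And>c x. c \<in> carrier F \<Longrightarrow> x \<in> \<pi> \<Longrightarrow> c \<odot>\<^bsub>vec 4\<^esub> x \<in> \<pi>"
    using \<pi>_sub by (auto simp: subspace_vec_iff)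
  obtain \<psi> where hom: "\<psi> \<in> module_hom F (vec 3) ((vec 4)\<lparr>carrier := \<pi>\<rparr>)"
    and bij: "bij_betw \<psi> (carrier (vec 3)) \<pi>"
    using coordinate_isomorphism[OF vectorspace.subspace_is_vs[OF vec_vectorspace \<pi>_sub]]
      subspace_finite[OF \<pi>_sub] dim by auto
  have \<psi>_in: "\<psi> x \<in> \<pi>" if "x \<in> carrier (vec 3)" for x
    using bij that by (auto simp: bij_betw_def)
  then have \<psi>_closed: "\<psi> x \<in> carrier (vec 4)" if "x \<in> carrier (vec 3)" for x
    using \<pi>_closed that by blast
  have \<psi>_add: "\<psi> (x \<oplus>\<^bsub>vec 3\<^esub> y) = \<psi> x \<oplus>\<^bsub>vec 4\<^esub> \<psi> y"
    if "x \<in> carrier (vec 3)" "y \<in> carrier (vec 3)" for x y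
    using module_hom_add[OF hom that] by simp
  have \<psi>_smult: "\<psi> (c \<odot>\<^bsub>vec 3\<^esub> x) = c \<odot>\<^bsub>vec 4\<^esub> \<psi> x"
    if "c \<in> carrier F" "x \<in> carrier (vec 3)" for c x
    using module_hom_smult[OF hom that] by simp
  have \<psi>_zero: "\<psi> \<zero>\<^bsub>vec 3\<^esub> = \<zero>\<^bsub>vec 4\<^esub>"
    using \<psi>_smult[of \<zero> "\<zero>\<^bsub>vec 3\<^esub>"] \<psi>_closed by simp
  obtain v where v: "v \<in> V" "v \<notin> \<pi>" using nsub by blast
  then have v_closed: "v \<in> carrier (vec 4)" using V_sub by (auto simp: subspace_vec_iff)
  have "\<zero>\<^bsub>vec 4\<^esub> \<in> \<pi>" using \<pi>_sub by (simp add: subspace_vec_iff)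
  then have "v \<noteq> \<zero>\<^bsub>vec 4\<^esub>" using v by blast
  then have V_line: "V = line 4 v" using subspace_card_order_eq_line V_sub v by blast
  interpret M: module F "vec 4" by (rule vec_module)
  \<comment> \<open>This is the directness of the sum: a nonzero multiple of \<open>v\<close> in the
    plane could be scaled back to \<open>v\<close>, which lies outside it.\<close>
  have coeff: "z = \<zero>" if "z \<in> carrier F" "z \<odot>\<^bsub>vec 4\<^esub> v \<in> \<pi>" for z
  proof (rule ccontr)
    assume "z \<noteq> \<zero>"
    then have "inv z \<odot>\<^bsub>vec 4\<^esub> (z \<odot>\<^bsub>vec 4\<^esub> v) = v" "inv z \<in> carrier F"
      using field_inverse[OF that(1)] that v_closed by (auto simp: vec_smult_assoc)
    then show False using \<pi>_smult[of "inv z" "z \<odot>\<^bsub>vec 4\<^esub> v"] that v by simp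
  qed
  define \<Theta> where "\<Theta> x z = \<psi> x \<oplus>\<^bsub>vec 4\<^esub> z \<odot>\<^bsub>vec 4\<^esub> v" for x z
  have inj: "inj_on (\<lambda>(x, z). \<Theta> x z) (carrier (vec 3) \<times> carrier F)"
  proof (rule inj_onI, clarify)
    fix x z y w assume *: "x \<in> carrier (vec 3)" "z \<in> carrier F" "y \<in> carrier (vec 3)" "w \<in> carrier F"
      and eq: "\<Theta> x z = \<Theta> y w"
    \<comment> \<open>Rearranging \<open>\<Theta> x z = \<Theta> y w\<close> exhibits a multiple of
      \<open>v\<close> as a difference of two vectors of the plane. The identity is checked
      coordinate by coordinate, where it is one of field arithmetic.\<close>
    have "(z \<ominus> w) \<odot>\<^bsub>vec 4\<^esub> v = \<psi> y \<oplus>\<^bsub>vec 4\<^esub> (\<ominus> \<one>) \<odot>\<^bsub>vec 4\<^esub> \<psi> x"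
    proof (rule vec_eqI[of _ 4])
      fix i assume i: "i < (4::nat)"
      note closed = vec_coord[OF \<psi>_closed[OF *(1)] i] vec_coord[OF \<psi>_closed[OF *(3)] i]
        vec_coord[OF v_closed i] *(2,4)
      have "(z \<ominus> w) \<otimes> v i = (\<psi> x i \<oplus> z \<otimes> v i) \<ominus> \<psi> x i \<ominus> w \<otimes> v i"
        using closed by algebra
      also have "\<psi> x i \<oplus> z \<otimes> v i = \<psi> y i \<oplus> w \<otimes> v i"
        using arg_cong[OF eq, of "\<lambda>f. f i"] i by (simp add: \<Theta>_def)
      also have "\<psi> y i \<oplus> w \<otimes> v i \<ominus> \<psi> x i \<ominus> w \<otimes> v i = \<psi> y i \<oplus> (\<ominus> \<one>) \<otimes> \<psi> x i"
        using closed by algebra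
      finally have "(z \<ominus> w) \<otimes> v i = \<psi> y i \<oplus> (\<ominus> \<one>) \<otimes> \<psi> x i" .
      then show "((z \<ominus> w) \<odot>\<^bsub>vec 4\<^esub> v) i = (\<psi> y \<oplus>\<^bsub>vec 4\<^esub> (\<ominus> \<one>) \<odot>\<^bsub>vec 4\<^esub> \<psi> x) i"
        using i by simp
    qed (use * v_closed \<psi>_closed in auto)
    moreover have "\<psi> y \<oplus>\<^bsub>vec 4\<^esub> (\<ominus> \<one>) \<odot>\<^bsub>vec 4\<^esub> \<psi> x \<in> \<pi>"
      using * \<psi>_in by (intro \<pi>_add \<pi>_smult) auto
    ultimately have "z \<ominus> w = \<zero>"
      using coeff[of "z \<ominus> w"] * by simp
    then have zw: "z = w" using * by simp
    then have "\<psi> x = \<psi> y"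
      using eq * v_closed \<psi>_closed by (simp add: \<Theta>_def)
    then show "x = y \<and> z = w"
      using zw bij * by (auto simp: bij_betw_def inj_on_def)
  qed
  have "(\<lambda>(x, z). \<Theta> x z) ` (carrier (vec 3) \<times> carrier F) = carrier (vec 4)"
  proof (rule card_subset_eq[OF finite_vec])
    show "(\<lambda>(x, z). \<Theta> x z) ` (carrier (vec 3) \<times> carrier F) \<subseteq> carrier (vec 4)"
      using \<psi>_closed v_closed by (auto simp: \<Theta>_def)
    show "card ((\<lambda>(x, z). \<Theta> x z) ` (carrier (vec 3) \<times> carrier F)) = card (carrier (vec 4))"
      by (simp add: card_image[OF inj] card_cartesian_product card_vec) (simp add: order_def eval_nat_numeral)
  qed
  then have \<Theta>_bij: "bij_betw (\<lambda>(x, z). \<Theta> x z) (carrier (vec 3) \<times> carrier F) (carrier (vec 4))"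
    using inj by (simp add: bij_betw_def)
  interpret \<Theta>: projective_splitting F \<Theta>
  proof unfold_locales
    show "id \<in> ring_hom F F" by simp
    show "bij_betw (\<lambda>(x, z). \<Theta> x z) (carrier (vec 3) \<times> carrier F) (carrier (vec 4))"
      by (rule \<Theta>_bij)
  next
    fix x y z w assume "x \<in> carrier (vec 3)" "y \<in> carrier (vec 3)" "z \<in> carrier F" "w \<in> carrier F"
    then show "\<Theta> (x \<oplus>\<^bsub>vec 3\<^esub> y) (z \<oplus> w) = \<Theta> x z \<oplus>\<^bsub>vec 4\<^esub> \<Theta> y w"
      using v_closed \<psi>_closed unfolding \<Theta>_def
      by (simp add: \<psi>_add M.smult_l_distr M.add.m_ac)
  next
    fix c x z assume "c \<in> carrier F" "x \<in> carrier (vec 3)" "z \<in> carrier F"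
    then show "\<Theta> (id c \<odot>\<^bsub>vec 3\<^esub> x) (c \<otimes> z) = c \<odot>\<^bsub>vec 4\<^esub> \<Theta> x z"
      using v_closed \<psi>_closed unfolding \<Theta>_def
      by (simp add: \<psi>_smult M.smult_r_distr M.smult_assoc1)
  qed
  have "\<Theta>.vertex = V"
    using v_closed by (auto simp: \<Theta>.vertex_def \<Theta>.im_def V_line line_def \<Theta>_def \<psi>_zero image_iff)
  moreover have "\<Theta>.base (carrier (vec 3)) = \<psi> ` carrier (vec 3)"
    using v_closed \<psi>_closed by (auto simp: \<Theta>.base_def \<Theta>.im_def \<Theta>_def image_iff)
  then have "\<Theta>.base (carrier (vec 3)) = \<pi>"
    using bij by (simp add: bij_betw_def)
  ultimately show thesis
    using that[of \<Theta>] \<Theta>.projective_splitting_axioms by simp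
qed

end

section \<open>Field reduction and duality\<close>

locale field_reduction = K: finite_field K + F: finite_field F
  for K :: "'a ring" and F :: "'a ring" +
  fixes \<phi> :: "'a \<Rightarrow> 'a" and n :: nat and T :: "(nat \<Rightarrow> 'a) \<Rightarrow> nat \<Rightarrow> 'a"
  assumes order_K: "order K = order F ^ n"
    and \<phi>_hom: "\<phi> \<in> ring_hom F K"
    and T_hom: "T \<in> module_hom F (restrict_scalars \<phi> (coord_space K 3)) (coord_space F (3 * n))"
    and T_bij: "bij_betw T (carrier (coord_space K 3)) (carrier (coord_space F (3 * n)))"
begin

interpretation \<phi>: ring_hom_cring F K \<phi>
  by unfold_locales (rule \<phi>_hom)

lemma T_closed [simp]: "x \<in> carrier (K.vec 3) \<Longrightarrow> T x \<in> carrier (F.vec (3 * n))"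
  using T_bij by (auto simp: bij_betw_def)

lemma T_add:
  "x \<in> carrier (K.vec 3) \<Longrightarrow> y \<in> carrier (K.vec 3) \<Longrightarrow>
    T (x \<oplus>\<^bsub>K.vec 3\<^esub> y) = T x \<oplus>\<^bsub>F.vec (3 * n)\<^esub> T y"
  using module_hom_add[OF T_hom] by (simp add: restrict_scalars_def)

lemma T_smult:
  "c \<in> carrier F \<Longrightarrow> x \<in> carrier (K.vec 3) \<Longrightarrow>
    T (\<phi> c \<odot>\<^bsub>K.vec 3\<^esub> x) = c \<odot>\<^bsub>F.vec (3 * n)\<^esub> T x"
  using module_hom_smult[OF T_hom] by (simp add: restrict_scalars_def)

text \<open>The functional is read off from \<open>T\<close> itself: \<open>\<tau> x\<close> is
  coordinate \<open>j\<close> of the image of \<open>x\<close> times the first unit vector. As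
  \<open>T\<close> is injective, the image of that unit vector is nonzero, and \<open>j\<close> is
  an index where it does not vanish. The trace map would be another candidate; only linearity and
  the nonzero value at one matter here.\<close>

lemma linear_functional_exists:
  obtains \<tau> where "\<And>x. x \<in> carrier K \<Longrightarrow> \<tau> x \<in> carrier F"
    and "\<And>x y. x \<in> carrier K \<Longrightarrow> y \<in> carrier K \<Longrightarrow> \<tau> (x \<oplus>\<^bsub>K\<^esub> y) = \<tau> x \<oplus>\<^bsub>F\<^esub> \<tau> y"
    and "\<And>c x. c \<in> carrier F \<Longrightarrow> x \<in> carrier K \<Longrightarrow> \<tau> (\<phi> c \<otimes>\<^bsub>K\<^esub> x) = c \<otimes>\<^bsub>F\<^esub> \<tau> x"
    and "\<tau> \<one>\<^bsub>K\<^esub> \<noteq> \<zero>\<^bsub>F\<^esub>"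
proof -
  let ?e = "K.unit_vector 3 0"
  have T_zero: "T \<zero>\<^bsub>K.vec 3\<^esub> = \<zero>\<^bsub>F.vec (3 * n)\<^esub>"
    using T_smult[of "\<zero>\<^bsub>F\<^esub>" "\<zero>\<^bsub>K.vec 3\<^esub>"] by simp
  have "?e \<noteq> \<zero>\<^bsub>K.vec 3\<^esub>"
  proof
    assume "?e = \<zero>\<^bsub>K.vec 3\<^esub>"
    then have "?e 0 = \<zero>\<^bsub>K\<^esub>" by simp
    then show False by (simp add: K.unit_vector_def)
  qed
  then have "T ?e \<noteq> \<zero>\<^bsub>F.vec (3 * n)\<^esub>"
    using T_bij T_zero inj_onD[of T "carrier (K.vec 3)" ?e "\<zero>\<^bsub>K.vec 3\<^esub>"] by (auto simp: bij_betw_def)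
  then obtain j where j: "j < 3 * n" "T ?e j \<noteq> \<zero>\<^bsub>F\<^esub>"
    using F.vec_nonzero_coord[of "T ?e" "3 * n"] by auto
  show thesis
  proof (rule that[of "\<lambda>x. T (x \<odot>\<^bsub>K.vec 3\<^esub> ?e) j"])
    fix x y assume "x \<in> carrier K" "y \<in> carrier K"
    moreover from this have "(x \<oplus>\<^bsub>K\<^esub> y) \<odot>\<^bsub>K.vec 3\<^esub> ?e = x \<odot>\<^bsub>K.vec 3\<^esub> ?e \<oplus>\<^bsub>K.vec 3\<^esub> y \<odot>\<^bsub>K.vec 3\<^esub> ?e"
      using module.smult_l_distr[OF K.vec_module, of x y ?e 3] by simp
    ultimately show "T ((x \<oplus>\<^bsub>K\<^esub> y) \<odot>\<^bsub>K.vec 3\<^esub> ?e) j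
        = T (x \<odot>\<^bsub>K.vec 3\<^esub> ?e) j \<oplus>\<^bsub>F\<^esub> T (y \<odot>\<^bsub>K.vec 3\<^esub> ?e) j"
      using j by (simp add: T_add)
  next
    fix c x assume "c \<in> carrier F" "x \<in> carrier K"
    then show "T ((\<phi> c \<otimes>\<^bsub>K\<^esub> x) \<odot>\<^bsub>K.vec 3\<^esub> ?e) j = c \<otimes>\<^bsub>F\<^esub> T (x \<odot>\<^bsub>K.vec 3\<^esub> ?e) j"
      using j T_smult[of c "x \<odot>\<^bsub>K.vec 3\<^esub> ?e"] by (simp add: K.vec_smult_assoc)
  next
    fix x assume "x \<in> carrier K"
    then show "T (x \<odot>\<^bsub>K.vec 3\<^esub> ?e) j \<in> carrier F"
      using j by (intro F.vec_coord[OF T_closed]) simp_all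
  next
    show "T (\<one>\<^bsub>K\<^esub> \<odot>\<^bsub>K.vec 3\<^esub> ?e) j \<noteq> \<zero>\<^bsub>F\<^esub>"
      using j by simp
  qed
qed

text \<open>For a nonzero \<open>F\<close>-linear functional \<open>\<tau>\<close> on \<open>K\<close>, the form \<open>\<tau> (a \<bullet> x)\<close> on \<open>K\<^sup>3\<close> is
  nondegenerate over \<open>F\<close>, so it corresponds under \<open>T\<close> to the standard form; \<open>R\<close> is the adjoint.\<close>

lemma adjoint_exists:
  obtains \<tau> R where "\<And>x. x \<in> carrier K \<Longrightarrow> \<tau> x \<in> carrier F"
    and "\<And>c x. c \<in> carrier F \<Longrightarrow> x \<in> carrier K \<Longrightarrow> \<tau> (\<phi> c \<otimes>\<^bsub>K\<^esub> x) = c \<otimes>\<^bsub>F\<^esub> \<tau> x"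
    and "\<tau> \<one>\<^bsub>K\<^esub> \<noteq> \<zero>\<^bsub>F\<^esub>"
    and "bij_betw R (carrier (K.vec 3)) (carrier (F.vec (3 * n)))"
    and "\<And>a b. a \<in> carrier (K.vec 3) \<Longrightarrow> b \<in> carrier (K.vec 3) \<Longrightarrow>
      R (a \<oplus>\<^bsub>K.vec 3\<^esub> b) = R a \<oplus>\<^bsub>F.vec (3 * n)\<^esub> R b"
    and "\<And>c a. c \<in> carrier F \<Longrightarrow> a \<in> carrier (K.vec 3) \<Longrightarrow>
      R (\<phi> c \<odot>\<^bsub>K.vec 3\<^esub> a) = c \<odot>\<^bsub>F.vec (3 * n)\<^esub> R a"
    and "\<And>a x. a \<in> carrier (K.vec 3) \<Longrightarrow> x \<in> carrier (K.vec 3) \<Longrightarrow>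
      F.dot (3 * n) (R a) (T x) = \<tau> (K.dot 3 a x)"
proof -
  obtain \<tau> where \<tau>: "\<And>x. x \<in> carrier K \<Longrightarrow> \<tau> x \<in> carrier F"
    and \<tau>_add: "\<And>x y. x \<in> carrier K \<Longrightarrow> y \<in> carrier K \<Longrightarrow> \<tau> (x \<oplus>\<^bsub>K\<^esub> y) = \<tau> x \<oplus>\<^bsub>F\<^esub> \<tau> y"
    and \<tau>_smult: "\<And>c x. c \<in> carrier F \<Longrightarrow> x \<in> carrier K \<Longrightarrow> \<tau> (\<phi> c \<otimes>\<^bsub>K\<^esub> x) = c \<otimes>\<^bsub>F\<^esub> \<tau> x"
    and \<tau>_one: "\<tau> \<one>\<^bsub>K\<^esub> \<noteq> \<zero>\<^bsub>F\<^esub>"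
    using linear_functional_exists by blast
  let ?m = "3 * n"
  define T' where "T' = inv_into (carrier (K.vec 3)) T"
  have T': "T' y \<in> carrier (K.vec 3)" "T (T' y) = y" if "y \<in> carrier (F.vec ?m)" for y
    using bij_betwE[OF bij_betw_inv_into[OF T_bij]] bij_betw_inv_into_right[OF T_bij] that
    unfolding T'_def by blast+
  have T'_T: "T' (T x) = x" if "x \<in> carrier (K.vec 3)" for x
    using T_bij that unfolding T'_def bij_betw_def by simp
  have T'_add: "T' (x \<oplus>\<^bsub>F.vec ?m\<^esub> y) = T' x \<oplus>\<^bsub>K.vec 3\<^esub> T' y"
    if "x \<in> carrier (F.vec ?m)" "y \<in> carrier (F.vec ?m)" for x y
    using T'_T[of "T' x \<oplus>\<^bsub>K.vec 3\<^esub> T' y"] T'[OF that(1)] T'[OF that(2)] by (simp add: T_add)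
  have T'_smult: "T' (c \<odot>\<^bsub>F.vec ?m\<^esub> x) = \<phi> c \<odot>\<^bsub>K.vec 3\<^esub> T' x"
    if "c \<in> carrier F" "x \<in> carrier (F.vec ?m)" for c x
    using T'_T[of "\<phi> c \<odot>\<^bsub>K.vec 3\<^esub> T' x"] T'[OF that(2)] that(1) by (simp add: T_smult)
  \<comment> \<open>The entries are forced: pairing an adjoint image with unit vector
    \<open>i\<close> must give the form of \<open>a\<close> with the preimage of that unit vector
    under \<open>T\<close>.\<close>
  define R where "R a = (\<lambda>i\<in>{..<?m}. \<tau> (K.dot 3 a (T' (F.unit_vector ?m i))))" for a
  have R_coord: "R a i = \<tau> (K.dot 3 a (T' (F.unit_vector ?m i)))" if "i < ?m" for a i
    using that by (simp add: R_def)
  have R_closed: "R a \<in> carrier (F.vec ?m)" if "a \<in> carrier (K.vec 3)" for a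
    unfolding R_def F.carrier_vec by (intro PiE_I) (simp_all add: \<tau> T' that)
  have dot_R: "F.dot ?m (R a) y = \<tau> (K.dot 3 a (T' y))"
    if a: "a \<in> carrier (K.vec 3)" and y: "y \<in> carrier (F.vec ?m)" for a y
    unfolding R_def
  proof (rule F.linear_functional_eq_dot[OF _ _ _ y, symmetric])
    show "(\<lambda>y. \<tau> (K.dot 3 a (T' y))) \<in> carrier (F.vec ?m) \<rightarrow> carrier F"
      using T' a by (intro Pi_I \<tau>) simp
  next
    fix x y assume "x \<in> carrier (F.vec ?m)" "y \<in> carrier (F.vec ?m)"
    then show "\<tau> (K.dot 3 a (T' (x \<oplus>\<^bsub>F.vec ?m\<^esub> y))) = \<tau> (K.dot 3 a (T' x)) \<oplus>\<^bsub>F\<^esub> \<tau> (K.dot 3 a (T' y))"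
      using a by (simp add: T'_add K.dot_add_right T' \<tau>_add)
  next
    fix c x assume "c \<in> carrier F" "x \<in> carrier (F.vec ?m)"
    then show "\<tau> (K.dot 3 a (T' (c \<odot>\<^bsub>F.vec ?m\<^esub> x))) = c \<otimes>\<^bsub>F\<^esub> \<tau> (K.dot 3 a (T' x))"
      using a by (simp add: T'_smult K.dot_smult_right T' \<tau>_smult)
  qed
  have dot_R_T: "F.dot ?m (R a) (T x) = \<tau> (K.dot 3 a x)"
    if "a \<in> carrier (K.vec 3)" "x \<in> carrier (K.vec 3)" for a x
    using dot_R[OF that(1) T_closed[OF that(2)]] T'_T[OF that(2)] by simp
  have R_add: "R (a \<oplus>\<^bsub>K.vec 3\<^esub> b) = R a \<oplus>\<^bsub>F.vec ?m\<^esub> R b"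
    if "a \<in> carrier (K.vec 3)" "b \<in> carrier (K.vec 3)" for a b
    using that by (intro F.vec_eqI[of _ ?m]) (simp_all add: R_closed R_coord K.dot_add_left T' \<tau>_add)
  have R_smult: "R (\<phi> c \<odot>\<^bsub>K.vec 3\<^esub> a) = c \<odot>\<^bsub>F.vec ?m\<^esub> R a"
    if "c \<in> carrier F" "a \<in> carrier (K.vec 3)" for c a
    using that by (intro F.vec_eqI[of _ ?m]) (simp_all add: R_closed R_coord K.dot_smult_left T' \<tau>_smult)
  have "inj_on R (carrier (K.vec 3))"
  proof (rule inj_onI)
    fix a b assume ab: "a \<in> carrier (K.vec 3)" "b \<in> carrier (K.vec 3)" "R a = R b"
    show "a = b"
    proof (rule K.vec_eqI[OF ab(1,2)])
      fix i assume i: "i < (3::nat)"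
      show "a i = b i"
      proof (rule ccontr)
        assume neq: "a i \<noteq> b i"
        have [simp]: "a i \<in> carrier K" "b i \<in> carrier K" using ab i by auto
        define d where "d = a i \<ominus>\<^bsub>K\<^esub> b i"
        have d: "d \<in> carrier K" "d \<noteq> \<zero>\<^bsub>K\<^esub>" using neq by (auto simp: d_def)
        note inv = K.field_inverse[OF d]
        \<comment> \<open>This vector is scaled so that its products with \<open>a\<close> and
          \<open>b\<close> differ by exactly one. Equality of \<open>R a\<close> and
          \<open>R b\<close> would then make \<open>\<tau> \<one>\<close> vanish.\<close>
        let ?x = "inv\<^bsub>K\<^esub> d \<odot>\<^bsub>K.vec 3\<^esub> K.unit_vector 3 i"
        have dot_x: "K.dot 3 c ?x = inv\<^bsub>K\<^esub> d \<otimes>\<^bsub>K\<^esub> c i" if "c \<in> carrier (K.vec 3)" for c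
          using that inv i by (simp add: K.dot_smult_right)
        have "inv\<^bsub>K\<^esub> d \<otimes>\<^bsub>K\<^esub> a i = \<one>\<^bsub>K\<^esub> \<oplus>\<^bsub>K\<^esub> inv\<^bsub>K\<^esub> d \<otimes>\<^bsub>K\<^esub> b i"
        proof -
          have "a i = d \<oplus>\<^bsub>K\<^esub> b i" by (simp add: d_def K.minus_eq K.a_assoc K.l_neg)
          then show ?thesis using inv d by (simp add: K.r_distr)
        qed
        then have "\<tau> (K.dot 3 a ?x) = \<tau> \<one>\<^bsub>K\<^esub> \<oplus>\<^bsub>F\<^esub> \<tau> (K.dot 3 b ?x)"
          using ab inv by (simp add: dot_x \<tau>_add)
        moreover have "\<tau> (K.dot 3 a ?x) = \<tau> (K.dot 3 b ?x)"
          using dot_R_T[OF ab(1), of ?x] dot_R_T[OF ab(2), of ?x] ab(3) inv by simp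
        moreover have "\<tau> (K.dot 3 b ?x) \<in> carrier F" "\<tau> \<one>\<^bsub>K\<^esub> \<in> carrier F"
          using ab inv by (auto intro: \<tau>)
        ultimately show False
          using \<tau>_one F.add.r_cancel_one' by metis
      qed
    qed
  qed
  \<comment> \<open>\<open>T\<close> shows that both spaces have the same number of elements, so
    injectivity is enough.\<close>
  moreover have "R ` carrier (K.vec 3) = carrier (F.vec ?m)"
  proof (rule card_subset_eq[OF F.finite_vec])
    show "R ` carrier (K.vec 3) \<subseteq> carrier (F.vec ?m)" using R_closed by blast
    show "card (R ` carrier (K.vec 3)) = card (carrier (F.vec ?m))"
      using card_image[OF \<open>inj_on R _\<close>] bij_betw_same_card[OF T_bij] by simp
  qed
  ultimately have "bij_betw R (carrier (K.vec 3)) (carrier (F.vec ?m))"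
    by (simp add: bij_betw_def)
  then show thesis
    using that[of \<tau> R] \<tau> \<tau>_smult \<tau>_one R_add R_smult dot_R_T by blast
qed

text \<open>The elements of the dual pseudo-oval consist of vectors acting on F^(3n) by the standard
  form. For \<open>R a\<close> this action, pulled back along \<open>T\<close>, is
  \<open>\<tau>\<close> of the product with \<open>a\<close>, so it vanishes on the image of
  \<open>P\<close> exactly when \<open>a\<close> annihilates \<open>P\<close> over
  \<open>K\<close>.\<close>

theorem oval_plane_isomorphic_L_structure:
  assumes B: "B \<subseteq> pg_subspaces K 2 0"
  shows "isomorphic (K.oval_plane B) (L_structure F n (perp F (3 * n) ` (\<lambda>P. T ` P) ` B))"
proof -
  let ?m = "3 * n"
  obtain \<tau> R where \<tau>: "\<And>x. x \<in> carrier K \<Longrightarrow> \<tau> x \<in> carrier F"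
    and \<tau>_smult: "\<And>c x. c \<in> carrier F \<Longrightarrow> x \<in> carrier K \<Longrightarrow> \<tau> (\<phi> c \<otimes>\<^bsub>K\<^esub> x) = c \<otimes>\<^bsub>F\<^esub> \<tau> x"
    and \<tau>_one: "\<tau> \<one>\<^bsub>K\<^esub> \<noteq> \<zero>\<^bsub>F\<^esub>"
    and R_bij: "bij_betw R (carrier (K.vec 3)) (carrier (F.vec ?m))"
    and R_add: "\<And>a b. a \<in> carrier (K.vec 3) \<Longrightarrow> b \<in> carrier (K.vec 3) \<Longrightarrow>
      R (a \<oplus>\<^bsub>K.vec 3\<^esub> b) = R a \<oplus>\<^bsub>F.vec ?m\<^esub> R b"
    and R_smult: "\<And>c a. c \<in> carrier F \<Longrightarrow> a \<in> carrier (K.vec 3) \<Longrightarrow>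
      R (\<phi> c \<odot>\<^bsub>K.vec 3\<^esub> a) = c \<odot>\<^bsub>F.vec ?m\<^esub> R a"
    and dot_R: "\<And>a x. a \<in> carrier (K.vec 3) \<Longrightarrow> x \<in> carrier (K.vec 3) \<Longrightarrow>
      F.dot ?m (R a) (T x) = \<tau> (K.dot 3 a x)"
    using adjoint_exists by blast
  have R_closed: "R a \<in> carrier (F.vec ?m)" if "a \<in> carrier (K.vec 3)" for a
    using R_bij that by (auto simp: bij_betw_def)
  have \<tau>_zero: "\<tau> \<zero>\<^bsub>K\<^esub> = \<zero>\<^bsub>F\<^esub>"
    using \<tau>_smult[of "\<zero>\<^bsub>F\<^esub>" "\<zero>\<^bsub>K\<^esub>"] \<tau> by simp
  \<comment> \<open>Index \<open>3 * n\<close> is the coordinate that vanishes at infinity, so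
    \<open>z\<close> measures the distance from the hyperplane and \<open>R a\<close> fills the
    remaining entries.\<close>
  define \<Theta> where "\<Theta> a z = (R a)(?m := z)" for a z
  interpret S: semilinear_splitting K F \<phi> "?m + 1" \<Theta>
  proof unfold_locales
    show "\<phi> \<in> ring_hom F K" by (rule \<phi>_hom)
  next
    show "bij_betw (\<lambda>(a, z). \<Theta> a z) (carrier (K.vec 3) \<times> carrier F) (carrier (F.vec (?m + 1)))"
    proof -
      have "bij_betw (map_prod R id) (carrier (K.vec 3) \<times> carrier F) (carrier (F.vec ?m) \<times> carrier F)"
        using R_bij by (intro bij_betw_map_prod) auto
      from bij_betw_trans[OF this F.vec_extend_bij] show ?thesis
        by (simp add: \<Theta>_def comp_def split_def map_prod_def)
    qed
  next
    fix a b z w assume "a \<in> carrier (K.vec 3)" "b \<in> carrier (K.vec 3)"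
    then show "\<Theta> (a \<oplus>\<^bsub>K.vec 3\<^esub> b) (z \<oplus>\<^bsub>F\<^esub> w) = \<Theta> a z \<oplus>\<^bsub>F.vec (?m + 1)\<^esub> \<Theta> b w"
      by (simp add: \<Theta>_def R_add F.vec_extend_add)
  next
    fix c a z assume "c \<in> carrier F" "a \<in> carrier (K.vec 3)"
    then show "\<Theta> (\<phi> c \<odot>\<^bsub>K.vec 3\<^esub> a) (c \<otimes>\<^bsub>F\<^esub> z) = c \<odot>\<^bsub>F.vec (?m + 1)\<^esub> \<Theta> a z"
      by (simp add: \<Theta>_def R_smult F.vec_extend_smult)
  qed
  show ?thesis
  proof (rule S.oval_plane_isomorphic_L_structure[OF _ order_K B])
    show "hyperplane_at_infinity F n = S.im (carrier (K.vec 3) \<times> {\<zero>\<^bsub>F\<^esub>})"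
    proof (intro equalityI subsetI)
      fix x assume "x \<in> hyperplane_at_infinity F n"
      then have "x \<in> carrier (F.vec (?m + 1))" "x ?m = \<zero>\<^bsub>F\<^esub>"
        by (auto simp: hyperplane_at_infinity_def)
      then obtain a z where "a \<in> carrier (K.vec 3)" "z \<in> carrier F" "x = \<Theta> a z"
        by (blast elim: S.\<Theta>_cases)
      then show "x \<in> S.im (carrier (K.vec 3) \<times> {\<zero>\<^bsub>F\<^esub>})"
        using \<open>x ?m = \<zero>\<^bsub>F\<^esub>\<close> by (auto simp: S.im_def \<Theta>_def)
    next
      fix x assume "x \<in> S.im (carrier (K.vec 3) \<times> {\<zero>\<^bsub>F\<^esub>})"
      then obtain a where "a \<in> carrier (K.vec 3)" "x = \<Theta> a \<zero>\<^bsub>F\<^esub>"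
        by (auto simp: S.im_def)
      then show "x \<in> hyperplane_at_infinity F n"
        using S.\<Theta>_closed[of a "\<zero>\<^bsub>F\<^esub>"] by (simp add: hyperplane_at_infinity_def \<Theta>_def)
    qed
    have "at_infinity F n (perp F ?m (T ` P)) = S.annihilator P" if "P \<in> B" for P
    proof -
      have P: "P \<in> pg_subspaces K 2 0" using B that by blast
      note rep = K.rep[OF P]
      have in_perp: "R a \<in> perp F ?m (T ` P) \<longleftrightarrow> K.dot 3 a (K.rep P) = \<zero>\<^bsub>K\<^esub>"
        if a: "a \<in> carrier (K.vec 3)" for a
      proof -
        define d where "d = K.dot 3 a (K.rep P)"
        have d: "d \<in> carrier K" using a rep by (simp add: d_def)
        have "R a \<in> perp F ?m (T ` P) \<longleftrightarrow> (\<forall>x\<in>P. F.dot ?m (R a) (T x) = \<zero>\<^bsub>F\<^esub>)"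
          using R_closed[OF a] by (simp add: perp_def F.dot_def)
        also have "\<dots> \<longleftrightarrow> (\<forall>c\<in>carrier K. F.dot ?m (R a) (T (c \<odot>\<^bsub>K.vec 3\<^esub> K.rep P)) = \<zero>\<^bsub>F\<^esub>)"
          by (subst rep(4)) (simp add: K.line_def)
        also have "\<dots> \<longleftrightarrow> (\<forall>c\<in>carrier K. \<tau> (c \<otimes>\<^bsub>K\<^esub> d) = \<zero>\<^bsub>F\<^esub>)"
          using a rep(3) by (simp add: dot_R K.dot_smult_right d_def)
        \<comment> \<open>Closure of \<open>P\<close> under \<open>K\<close> means that
          \<open>\<tau>\<close> is tested on all \<open>K\<close>-multiples of \<open>d\<close>. If
          \<open>d\<close> is nonzero, one of them is \<open>\<one>\<close>, where
          \<open>\<tau>\<close> does not vanish. This is where an annihilator over \<open>F\<close>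
          becomes one over \<open>K\<close>.\<close>
        also have "\<dots> \<longleftrightarrow> d = \<zero>\<^bsub>K\<^esub>"
        proof
          assume all: "\<forall>c\<in>carrier K. \<tau> (c \<otimes>\<^bsub>K\<^esub> d) = \<zero>\<^bsub>F\<^esub>"
          show "d = \<zero>\<^bsub>K\<^esub>"
          proof (rule ccontr)
            assume "d \<noteq> \<zero>\<^bsub>K\<^esub>"
            then show False
              using all K.field_inverse[OF d] \<tau>_one by force
          qed
        qed (simp add: \<tau>_zero)
        finally show ?thesis by (simp add: d_def)
      qed
      have R_onto: "\<exists>a\<in>carrier (K.vec 3). y = R a" if "y \<in> carrier (F.vec ?m)" for y
        using R_bij that by (auto simp: bij_betw_def image_iff)
      have "perp F ?m (T ` P) = R ` {a \<in> carrier (K.vec 3). K.dot 3 a (K.rep P) = \<zero>\<^bsub>K\<^esub>}"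
      proof (intro equalityI subsetI)
        fix y assume y: "y \<in> perp F ?m (T ` P)"
        then have "y \<in> carrier (F.vec ?m)" by (simp add: perp_def)
        then obtain a where "a \<in> carrier (K.vec 3)" "y = R a" using R_onto by blast
        then show "y \<in> R ` {a \<in> carrier (K.vec 3). K.dot 3 a (K.rep P) = \<zero>\<^bsub>K\<^esub>}"
          using in_perp y by blast
      qed (use in_perp in blast)
      then have "at_infinity F n (perp F ?m (T ` P))
          = (\<lambda>a. \<Theta> a \<zero>\<^bsub>F\<^esub>) ` {a \<in> carrier (K.vec 3). K.dot 3 a (K.rep P) = \<zero>\<^bsub>K\<^esub>}"
        by (simp add: at_infinity_def \<Theta>_def image_image)
      also have "\<dots> = S.annihilator P"
        unfolding S.annihilator_def S.im_def by force
      finally show ?thesis .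
    qed
    then show "at_infinity F n ` perp F ?m ` (\<lambda>P. T ` P) ` B = S.annihilator ` B"
      unfolding image_image by (intro image_cong refl)
  qed simp
qed

end

section \<open>Comparison of the two descriptions through the model\<close>

lemma galois_field_iff_finite_field: "galois_field F \<longleftrightarrow> finite_field F"
  by (simp add: galois_field_def finite_field_def finite_field_axioms_def)

text \<open>Adapted coordinates remove the dependence on the vertex and the base plane, leaving only
  an oval of PG(2, K). Conversely, the standard splitting realises every such oval as the base of a
  cone.\<close>

lemma ovoidal_iff_oval_plane:
  fixes L :: "('p, 'l, 'c) plc_structure"
  shows "ovoidal L \<longleftrightarrow> (\<exists>(K :: nat ring) B. galois_field K \<and>
    oval K 2 (carrier (coord_space K 3)) B \<and> isomorphic L (finite_field.oval_plane K B))"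
proof
  assume "ovoidal L"
  then obtain K :: "nat ring" and V \<pi> B where K: "galois_field K" "V \<in> pg_subspaces K 3 0"
    "\<not> V \<subseteq> \<pi>" "oval K 3 \<pi> B" "isomorphic L (cone_structure K V B)"
    unfolding ovoidal_def by blast
  interpret finite_field K using K by (simp add: galois_field_iff_finite_field)
  have "\<pi> \<in> pg_subspaces K 3 2" using K(4) by (simp add: oval_def)
  then obtain \<Theta> where \<Theta>: "projective_splitting K \<Theta>"
    "V = projective_splitting.vertex K \<Theta>" "\<pi> = projective_splitting.base K \<Theta> (carrier (vec 3))"
    using projective_splitting_exists K by blast
  interpret \<Theta>: projective_splitting K \<Theta> by fact
  obtain B' where B': "oval K 2 (carrier (vec 3)) B'" "B = \<Theta>.base ` B'"
    using \<Theta>.oval_from_base K(4) \<Theta>(3) by blast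
  have "isomorphic L (oval_plane B')"
    using isomorphic_trans[OF K(5)] isomorphic_sym \<Theta>.oval_plane_isomorphic_cone_structure[OF B'(1)]
      B'(2) \<Theta>(2) by metis
  then show "\<exists>(K :: nat ring) B. galois_field K \<and>
      oval K 2 (carrier (coord_space K 3)) B \<and> isomorphic L (finite_field.oval_plane K B)"
    using K(1) B'(1) by blast
next
  assume "\<exists>(K :: nat ring) B. galois_field K \<and>
    oval K 2 (carrier (coord_space K 3)) B \<and> isomorphic L (finite_field.oval_plane K B)"
  then obtain K :: "nat ring" and B where K: "galois_field K"
    "oval K 2 (carrier (coord_space K 3)) B" "isomorphic L (finite_field.oval_plane K B)"
    by blast
  interpret finite_field K using K by (simp add: galois_field_iff_finite_field)
  interpret \<Theta>: projective_splitting K "\<lambda>x z. x(3 := z)" by (rule standard_projective_splitting)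
  have "\<Theta>.vertex \<in> pg_subspaces K 3 0"
    using \<Theta>.subspace_vertex \<Theta>.card_vertex by (simp add: pg_subspaces_iff)
  moreover have "\<not> \<Theta>.vertex \<subseteq> \<Theta>.base (carrier (vec 3))"
  proof
    assume "\<Theta>.vertex \<subseteq> \<Theta>.base (carrier (vec 3))"
    then show False
      using \<Theta>.in_vertex_iff[of "\<zero>\<^bsub>vec 3\<^esub>" "\<one>\<^bsub>K\<^esub>"]
        \<Theta>.in_base_iff[of "carrier (vec 3)" "\<zero>\<^bsub>vec 3\<^esub>" "\<one>\<^bsub>K\<^esub>"] by auto
  qed
  moreover have "isomorphic L (cone_structure K \<Theta>.vertex (\<Theta>.base ` B))"
    using isomorphic_trans[OF K(3) \<Theta>.oval_plane_isomorphic_cone_structure[OF K(2)]] .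
  ultimately show "ovoidal L"
    unfolding ovoidal_def using K(1) \<Theta>.oval_base[OF K(2)] by blast
qed

text \<open>Field reduction along the identity changes nothing, and the spanning condition on three
  elements is the non-collinearity of an oval in the form of \<open>oval_span_eq\<close>.\<close>

lemma elementary_pseudo_oval_oval:
  fixes F :: "nat ring"
  assumes F: "galois_field F" and B: "oval F 2 (carrier (coord_space F 3)) B"
  shows "elementary_pseudo_oval F 1 B"
proof -
  interpret finite_field F using F by (simp add: galois_field_iff_finite_field)
  have "LinearCombinations.module.span F (vec 3) (X \<union> Y \<union> Z) = carrier (vec 3)"
    if XYZ: "X \<in> B" "Y \<in> B" "Z \<in> B" "X \<noteq> Y" "X \<noteq> Z" "Y \<noteq> Z" for X Y Z
  proof -
    interpret V: vectorspace F "vec 3" by (rule vec_vectorspace)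
    have sub: "X \<union> Y \<union> Z \<subseteq> carrier (vec 3)"
      using B XYZ(1-3) by (auto simp: oval_def)
    have "X \<union> Y \<union> Z \<subseteq> V.span (X \<union> Y \<union> Z)"
      using sub by (rule V.in_own_span)
    then show ?thesis
      using oval_span_eq[OF B XYZ V.span_is_subspace[OF sub]] by simp
  qed
  moreover have "B \<subseteq> pg_subspaces F 2 0" "card B = order F + 1"
    using B by (auto simp: oval_def)
  ultimately have "pseudo_oval F 1 B"
    by (simp add: pseudo_oval_def)
  moreover have "id \<in> module_hom F (restrict_scalars id (vec 3)) (vec (3 * 1))"
    by (simp add: module_hom_def restrict_scalars_def)
  moreover have "bij_betw id (carrier (vec 3)) (carrier (vec (3 * 1)))"
    by simp
  moreover have "B = (\<lambda>P. id ` P) ` B" by simp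
  ultimately show ?thesis
    unfolding elementary_pseudo_oval_def using F B id_ring_hom[of F] power_one_right[of "order F"]
    by metis
qed

text \<open>Being elementary supplies a field, an embedding, a linear bijection and an oval, which
  are the data of \<open>field_reduction\<close> together with the oval of the model.\<close>

lemma elementary_dual_pseudo_oval_isomorphic_oval_plane:
  assumes F: "galois_field F" and D: "elementary_dual_pseudo_oval F n D"
  obtains K :: "nat ring" and B where "galois_field K" "oval K 2 (carrier (coord_space K 3)) B"
    "isomorphic (finite_field.oval_plane K B) (L_structure F n D)"
proof -
  obtain A where A: "elementary_pseudo_oval F n A" "D = perp F (3 * n) ` A"
    using D by (auto simp: elementary_dual_pseudo_oval_def)
  then obtain K :: "nat ring" and \<phi> T B where K: "galois_field K" "order K = order F ^ n"
    "\<phi> \<in> ring_hom F K"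
    "T \<in> module_hom F (restrict_scalars \<phi> (coord_space K 3)) (coord_space F (3 * n))"
    "bij_betw T (carrier (coord_space K 3)) (carrier (coord_space F (3 * n)))"
    "oval K 2 (carrier (coord_space K 3)) B" "A = (\<lambda>P. T ` P) ` B"
    unfolding elementary_pseudo_oval_def by blast
  interpret field_reduction K F \<phi> n T
    using F K by (simp add: field_reduction_def field_reduction_axioms_def galois_field_iff_finite_field)
  have "B \<subseteq> pg_subspaces K 2 0" using K(6) by (auto simp: oval_def)
  then have "isomorphic (K.oval_plane B) (L_structure F n D)"
    unfolding A(2) K(7) by (rule oval_plane_isomorphic_L_structure)
  then show thesis using that K by blast
qed

theorem theorem2p4:
  fixes L :: "('p, 'l, 'c) plc_structure"
  assumes "finite_structure L"
    and "elation_laguerre_plane L"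
  shows "ovoidal L \<longleftrightarrow>
    (\<exists>(F :: nat ring) (n :: nat) D.
       galois_field F \<and> n \<ge> 1 \<and> elementary_dual_pseudo_oval F n D \<and>
       isomorphic L (L_structure F n D))"
proof
  assume "ovoidal L"
  then obtain K :: "nat ring" and B where K: "galois_field K"
    "oval K 2 (carrier (coord_space K 3)) B" "isomorphic L (finite_field.oval_plane K B)"
    unfolding ovoidal_iff_oval_plane by blast
  \<comment> \<open>The trivial reduction of \<open>K\<close> to itself: \<open>T\<close> is the
    identity, and the dual pseudo-oval consists of the perps of the points of the oval.\<close>
  interpret field_reduction K K id 1 id
    using K(1) by (simp add: field_reduction_def field_reduction_axioms_def
        galois_field_iff_finite_field module_hom_def restrict_scalars_def)
  let ?D = "perp K (3 * 1) ` B"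
  have "elementary_dual_pseudo_oval K 1 ?D"
    using elementary_pseudo_oval_oval[OF K(1,2)] by (auto simp: elementary_dual_pseudo_oval_def)
  moreover have "isomorphic L (L_structure K 1 ?D)"
  proof -
    have "B \<subseteq> pg_subspaces K 2 0" using K(2) by (auto simp: oval_def)
    from oval_plane_isomorphic_L_structure[OF this] show ?thesis
      by (intro isomorphic_trans[OF K(3)]) simp
  qed
  ultimately show "\<exists>(F :: nat ring) (n :: nat) D.
      galois_field F \<and> n \<ge> 1 \<and> elementary_dual_pseudo_oval F n D \<and> isomorphic L (L_structure F n D)"
    using K(1) by blast
next
  assume "\<exists>(F :: nat ring) (n :: nat) D.
    galois_field F \<and> n \<ge> 1 \<and> elementary_dual_pseudo_oval F n D \<and> isomorphic L (L_structure F n D)"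
  then show "ovoidal L"
    unfolding ovoidal_iff_oval_plane
    by (metis elementary_dual_pseudo_oval_isomorphic_oval_plane isomorphic_sym isomorphic_trans)
qed

end
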